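(* Let $X,Y$ be Banach spaces, $D\subset X$ a nonempty open convex set, and $F:D\to Y$ a twice continuously (Fréchet) differentiable operator. Let $x_0\in D$ be such that $F'(x_0)^{-1}$ exists, let $\beta,\gamma>0$, and assume $B(x_0,1/\gamma)\subset D$. Suppose that $$\|F'(x_0)^{-1}[F''(y)-F''(x)]\|\le\frac{2\gamma}{(1-\gamma\|y-x\|-\gamma\|x-x_0\|)^3}-\frac{2\gamma}{(1-\gamma\|x-x_0\|)^3}$$ for all $x,y\in B(x_0,1/\gamma)$ with $\|y-x\|+\|x-x_0\|<1/\gamma$, and that $\|F'(x_0)^{-1}F(x_0)\|\le\beta$ and $\|F'(x_0)^{-1}F''(x_0)\|\le2\gamma$. If $\alpha:=\beta\gamma<3-2\sqrt2$, then, with $$t^*=\frac{1+\alpha-\sqrt{(1+\alpha)^2-8\alpha}}{4\gamma},\qquad t^{**}=\frac{1+\alpha+\sqrt{(1+\alpha)^2-8\alpha}}{4\gamma},$$ the sequence $\{x_k\}$ generated by Halley's method $$x_{k+1}=x_k-[I-L_F(x_k)]^{-1}F'(x_k)^{-1}F(x_k),\quad k=0,1,2,\ldots,$$ with starting point $x_0$ is well defined, is contained in $B(x_0,t^* )$, and converges to a point $x^*\in\overline{B(x_0,t^* )}$ which is a solution of $F(x)=0$. The limit $x^*$ is the unique zero of $F$ in $B(x_0,t^{**})$. Moreover, with $\{t_k\}$ the Halley sequence for $f$ started at $t_0=0$ (defined in the context), for all $k=0,1,\ldots$, $$\|x^*-x_{k+1}\|\le(t^*-t_{k+1})\left(\frac{\|x^*-x_k\|}{t^*-t_k}\right)^3,$$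 and $\{x_k\}$ converges Q-cubically with $$\|x^*-x_{k+1}\|\le\frac{8\gamma^2}{3[2(1-\gamma t^* )^2-1]^2}\,\|x^*-x_k\|^3.$$
   Context: $B(x,r)$ is the open ball with center $x$ and radius $r$, and $\overline{B(x,r)}$ its closure. $I$ is the identity operator. $L_F(x)=\frac12F'(x)^{-1}F''(x)F'(x)^{-1}F(x)$, i.e. the bounded linear operator $v\mapsto\frac12F'(x)^{-1}F''(x)\big(F'(x)^{-1}F(x),v\big)$ on $X$. The function $f$ is $f(t)=\beta-t+\frac{\gamma t^2}{1-\gamma t}$ for $0\le t<1/\gamma$. Halley sequence for $f$: $t_0=0$, $t_{k+1}=t_k-\frac{1}{1-L_f(t_k)}\cdot\frac{f(t_k)}{f'(t_k)}$, where $L_f(t)=\frac{f(t)f''(t)}{2f'(t)^2}$. A sequence $x_n\to x^*$ converges Q-cubically if there are constants $c\ge0$, $N\ge0$ with $\|x^*-x_{n+1}\|\le c\|x^*-x_n\|^3$ for all $n\ge N$. *)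

theory Defs
  imports "HOL-Analysis.Analysis"
begin

definition blinfun_invertible :: "('a::real_normed_vector \<Rightarrow>\<^sub>L 'b::real_normed_vector) \<Rightarrow> bool" where
  "blinfun_invertible A \<longleftrightarrow> (\<exists>B. B o\<^sub>L A = id_blinfun \<and> A o\<^sub>L B = id_blinfun)"

definition blinfun_inv :: "('a::real_normed_vector \<Rightarrow>\<^sub>L 'b::real_normed_vector) \<Rightarrow> 'b \<Rightarrow>\<^sub>L 'a" where
  "blinfun_inv A = (THE B. B o\<^sub>L A = id_blinfun \<and> A o\<^sub>L B = id_blinfun)"

lemma blinfun_inv_eqI:
  assumes "B o\<^sub>L A = id_blinfun" "A o\<^sub>L B = id_blinfun"
  shows "blinfun_inv A = B"
  unfolding blinfun_inv_def
proof (rule the_equality)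
  fix C assume C: "C o\<^sub>L A = id_blinfun \<and> A o\<^sub>L C = id_blinfun"
  show "C = B"
  proof (rule blinfun_eqI)
    fix y
    have "blinfun_apply (C o\<^sub>L A) (B y) = B y" using C by simp
    moreover have "blinfun_apply (A o\<^sub>L B) y = y" using assms by simp
    ultimately show "C y = B y" by simp
  qed
qed (use assms in simp)

lemma blinfun_inv:
  assumes "blinfun_invertible A"
  shows "blinfun_inv A o\<^sub>L A = id_blinfun" "A o\<^sub>L blinfun_inv A = id_blinfun"
  using assms blinfun_inv_eqI unfolding blinfun_invertible_def by metis+

text \<open>A bounded bilinear operator on \<open>X\<close> is represented by its curried form, on which the
  norm of iterated bounded linear maps is the usual norm of bilinear operators. The following is the
  composition \<open>(u, v) \<mapsto> A (B (u, v))\<close>.\<close>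

definition bilinear_postcomp ::
  "('b::real_normed_vector \<Rightarrow>\<^sub>L 'c::real_normed_vector) \<Rightarrow>
   ('a::real_normed_vector \<Rightarrow>\<^sub>L 'a \<Rightarrow>\<^sub>L 'b) \<Rightarrow> 'a \<Rightarrow>\<^sub>L 'a \<Rightarrow>\<^sub>L 'c" where
  "bilinear_postcomp A B = Blinfun (\<lambda>u. A o\<^sub>L blinfun_apply B u)"

lemma bilinear_postcomp_apply [simp]:
  "blinfun_apply (blinfun_apply (bilinear_postcomp A B) u) v = A (B u v)"
proof -
  have "bounded_linear (\<lambda>u. A o\<^sub>L blinfun_apply B u)"
    by (intro bounded_linear_intros blinfun.bounded_linear_right
        bounded_bilinear.bounded_linear_right[OF bounded_bilinear_blinfun_compose,
          THEN bounded_linear_compose])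
  then show ?thesis
    by (simp add: bilinear_postcomp_def bounded_linear_Blinfun_apply)
qed

text \<open>In the following, the arguments \<open>F'\<close> and \<open>F''\<close> stand for the first and second derivative
  of \<open>F\<close>.\<close>

definition halley_L ::
  "('a::real_normed_vector \<Rightarrow> 'b::real_normed_vector) \<Rightarrow> ('a \<Rightarrow> 'a \<Rightarrow>\<^sub>L 'b) \<Rightarrow>
   ('a \<Rightarrow> 'a \<Rightarrow>\<^sub>L 'a \<Rightarrow>\<^sub>L 'b) \<Rightarrow> 'a \<Rightarrow> 'a \<Rightarrow>\<^sub>L 'a" where
  "halley_L F F' F'' x =
     (1 / 2) *\<^sub>R (blinfun_inv (F' x) o\<^sub>L F'' x (blinfun_inv (F' x) (F x)))"

primrec halley_seq ::
  "('a::real_normed_vector \<Rightarrow> 'b::real_normed_vector) \<Rightarrow> ('a \<Rightarrow> 'a \<Rightarrow>\<^sub>L 'b) \<Rightarrow>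
   ('a \<Rightarrow> 'a \<Rightarrow>\<^sub>L 'a \<Rightarrow>\<^sub>L 'b) \<Rightarrow> 'a \<Rightarrow> nat \<Rightarrow> 'a" where
  "halley_seq F F' F'' x0 0 = x0"
| "halley_seq F F' F'' x0 (Suc k) =
     (let x = halley_seq F F' F'' x0 k
      in x - blinfun_inv (id_blinfun - halley_L F F' F'' x) (blinfun_inv (F' x) (F x)))"

text \<open>Because inversion is total here, that the sequence is well defined has to be said
  separately: no iterate leaves the domain, and every inverse that is used exists.\<close>

definition halley_well_defined ::
  "('a::real_normed_vector) set \<Rightarrow> ('a \<Rightarrow> 'b::real_normed_vector) \<Rightarrow> ('a \<Rightarrow> 'a \<Rightarrow>\<^sub>L 'b) \<Rightarrow>
   ('a \<Rightarrow> 'a \<Rightarrow>\<^sub>L 'a \<Rightarrow>\<^sub>L 'b) \<Rightarrow> 'a \<Rightarrow> bool" where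
  "halley_well_defined D F F' F'' x0 \<longleftrightarrow>
     (\<forall>k. let x = halley_seq F F' F'' x0 k
          in x \<in> D \<and> blinfun_invertible (F' x) \<and>
             blinfun_invertible (id_blinfun - halley_L F F' F'' x))"

definition scalar_halley_L :: "(real \<Rightarrow> real) \<Rightarrow> real \<Rightarrow> real" where
  "scalar_halley_L f t = f t * deriv (deriv f) t / (2 * (deriv f t)\<^sup>2)"

primrec scalar_halley_seq :: "(real \<Rightarrow> real) \<Rightarrow> real \<Rightarrow> nat \<Rightarrow> real" where
  "scalar_halley_seq f t0 0 = t0"
| "scalar_halley_seq f t0 (Suc k) =
     (let t = scalar_halley_seq f t0 k
      in t - 1 / (1 - scalar_halley_L f t) * (f t / deriv f t))"

text \<open>Only the values for \<open>0 \<le> t < 1 / \<gamma>\<close> are meaningful.\<close>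

definition majorant :: "real \<Rightarrow> real \<Rightarrow> real \<Rightarrow> real" where
  "majorant \<beta> \<gamma> t = \<beta> - t + \<gamma> * t\<^sup>2 / (1 - \<gamma> * t)"

definition q_cubically_convergent :: "(nat \<Rightarrow> 'a::real_normed_vector) \<Rightarrow> 'a \<Rightarrow> bool" where
  "q_cubically_convergent x l \<longleftrightarrow>
     x \<longlonglongrightarrow> l \<and>
     (\<exists>c\<ge>0. \<exists>N. \<forall>n\<ge>N. norm (l - x (Suc n)) \<le> c * norm (l - x n) ^ 3)"

end

theory Submission
  imports Defs
begin

text \<open>Replacing \<open>F\<close> by \<open>G = F'(x0)\<^sup>-\<^sup>1 F\<close> does not change Halley's iterates, so one may assume
  \<open>F'(x0) = I\<close>. The scalar Halley sequence \<open>t\<^sub>k\<close> of \<open>f\<close> then majorizes the operator one: by induction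
  \<open>\<parallel>x\<^sub>k - x0\<parallel> \<le> t\<^sub>k\<close> and \<open>\<parallel>G x\<^sub>k\<parallel> \<le> f t\<^sub>k\<close>, since with \<open>r = x\<^sub>k\<^sub>+\<^sub>1 - x\<^sub>k\<close> Halley's equation gives
  \<open>G x\<^sub>k\<^sub>+\<^sub>1 = G''(x\<^sub>k)(L r, r) / 2\<close> plus a third-order Taylor remainder, and \<open>f\<close> satisfies the same
  identity with nonnegative terms. Likewise \<open>(I - L)(x* - x\<^sub>k\<^sub>+\<^sub>1)\<close> is an expression in \<open>x* - x\<^sub>k\<close> all of
  whose terms are at least cubic, and whose scalar counterpart has nonnegative terms only. The scalar
  iteration is solved explicitly: with \<open>w = 1 - \<gamma> t\<close> and \<open>A\<close>, \<open>B\<close> (\<open>wa\<close>, \<open>wb\<close> below) the values of \<open>w\<close> at the two zeros of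
  \<open>f\<close>, one has \<open>2 A B = 1\<close> and a Halley step maps \<open>w - A\<close> to \<open>4 B (w - A)\<^sup>3 / (4 w\<^sup>3 - 6 w + 2 (A + B))\<close>.\<close>

section \<open>Inversion of bounded operators near the identity\<close>

text \<open>Banach's fixed point theorem takes the place of the Neumann series:
  \<open>M v = y\<close> says that \<open>v\<close> is a fixed point of the map sending
  \<open>v\<close> to \<open>y + (v - M v)\<close>, which is a contraction. The bound
  \<open>low\<close> then gives injectivity and the boundedness of the inverse.\<close>

lemma blinfun_near_id_invertible:
  fixes M :: "'a::banach \<Rightarrow>\<^sub>L 'a"
  assumes "norm (id_blinfun - M) < 1"
  shows "blinfun_invertible M"
proof -
  let ?q = "norm (id_blinfun - M)"
  have diff: "norm (v - M v) \<le> ?q * norm v" for v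
    using norm_blinfun[of "id_blinfun - M" v] by (simp add: blinfun.diff_left)
  have low: "(1 - ?q) * norm v \<le> norm (M v)" for v
    using diff[of v] norm_triangle_ineq2[of v "M v"]
    by (simp add: algebra_simps)
  have "\<exists>v. M v = y" for y
  proof -
    have "\<exists>!v. y + (v - M v) = v"
    proof (rule banach_fix_type)
      show "0 \<le> ?q" "?q < 1" using assms by simp_all
      show "\<forall>v w. dist (y + (v - M v)) (y + (w - M w)) \<le> ?q * dist v w"
      proof (intro allI)
        fix v w
        have eq: "y + (v - M v) - (y + (w - M w)) = (v - w) - M (v - w)"
          by (simp add: blinfun.diff_right)
        show "dist (y + (v - M v)) (y + (w - M w)) \<le> ?q * dist v w"
          unfolding dist_norm eq by (rule diff)
      qed
    qed
    then obtain v where "y + (v - M v) = v" by blast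
    then have "M v = y" by (simp add: algebra_simps)
    then show ?thesis ..
  qed
  then obtain g where g: "\<And>y. M (g y) = y" by metis
  have inj: "v = w" if "M v = M w" for v w
    using low[of "v - w"] that assms by (simp add: blinfun.diff_right mult_le_0_iff)
  have "bounded_linear g"
  proof (rule bounded_linear_intro)
    show "g (x + y) = g x + g y" for x y by (rule inj) (simp add: g blinfun.add_right)
    show "g (r *\<^sub>R x) = r *\<^sub>R g x" for r x by (rule inj) (simp add: g blinfun.scaleR_right)
    show "norm (g x) \<le> norm x * (1 / (1 - ?q))" for x
      using low[of "g x"] assms by (simp add: g field_simps)
  qed
  then have Bg: "blinfun_apply (Blinfun g) = g" by (rule bounded_linear_Blinfun_apply)
  have "g (M v) = v" for v by (rule inj) (rule g)
  then have "Blinfun g o\<^sub>L M = id_blinfun" by (intro blinfun_eqI) (simp add: Bg)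
  moreover have "M o\<^sub>L Blinfun g = id_blinfun" by (intro blinfun_eqI) (simp add: Bg g)
  ultimately show ?thesis unfolding blinfun_invertible_def by blast
qed

lemma blinfun_inv_apply:
  assumes "blinfun_invertible A"
  shows "blinfun_inv A (A v) = v" "A (blinfun_inv A w) = w"
  using blinfun_inv[OF assms] by (metis blinfun_apply_blinfun_compose blinfun_apply_id_blinfun)+

text \<open>If \<open>M w = v\<close>, then \<open>w - v\<close> equals
  \<open>(id_blinfun - M) w\<close> and so has norm at most \<open>q * norm w\<close>. Applied below
  both to \<open>G' x\<close> and to \<open>id_blinfun - L\<close>.\<close>

lemma norm_blinfun_inv_near_id:
  fixes M :: "'a::banach \<Rightarrow>\<^sub>L 'a"
  assumes "norm (id_blinfun - M) \<le> q" "q < 1"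
  shows "norm (blinfun_inv M v) \<le> norm v / (1 - q)"
proof -
  have inv: "blinfun_invertible M" using assms by (intro blinfun_near_id_invertible) simp
  define w where "w = blinfun_inv M v"
  have Mw: "M w = v" unfolding w_def using blinfun_inv_apply[OF inv] by simp
  have "norm (w - v) \<le> q * norm w"
    using norm_blinfun[of "id_blinfun - M" w] mult_right_mono[OF assms(1) norm_ge_zero, of w]
    by (simp add: blinfun.diff_left Mw)
  then have "(1 - q) * norm w \<le> norm v"
    using norm_triangle_sub[of w v] by (simp add: algebra_simps)
  then show ?thesis using assms(2) unfolding w_def by (simp add: field_simps)
qed

section \<open>The majorant and its derivatives\<close>

definition majorant_d1 :: "real \<Rightarrow> real \<Rightarrow> real" where
  "majorant_d1 \<gamma> t = 1 / (1 - \<gamma> * t)\<^sup>2 - 2"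

definition majorant_d2 :: "real \<Rightarrow> real \<Rightarrow> real" where
  "majorant_d2 \<gamma> t = 2 * \<gamma> / (1 - \<gamma> * t) ^ 3"

lemma has_derivative_majorant:
  assumes "\<gamma> * t < 1"
  shows "(majorant \<beta> \<gamma> has_field_derivative majorant_d1 \<gamma> t) (at t)"
proof -
  have "(majorant \<beta> \<gamma> has_field_derivative
      (0 - 1 + (\<gamma> * (2 * t) * (1 - \<gamma> * t) - (\<gamma> * t\<^sup>2) * (- \<gamma>)) / ((1 - \<gamma> * t) * (1 - \<gamma> * t)))) (at t)"
    unfolding majorant_def[abs_def]
    by (rule derivative_eq_intros refl | use assms in simp)+
  moreover have "0 - 1 + (\<gamma> * (2 * t) * (1 - \<gamma> * t) - (\<gamma> * t\<^sup>2) * (- \<gamma>)) / ((1 - \<gamma> * t) * (1 - \<gamma> * t))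
      = majorant_d1 \<gamma> t"
    using assms unfolding majorant_d1_def by (simp add: divide_simps) algebra
  ultimately show ?thesis by simp
qed

lemma has_derivative_majorant_d1:
  assumes "\<gamma> * t < 1"
  shows "(majorant_d1 \<gamma> has_field_derivative majorant_d2 \<gamma> t) (at t)"
proof -
  have "(majorant_d1 \<gamma> has_field_derivative
      (- (2 * (1 - \<gamma> * t) * (- \<gamma>)) / ((1 - \<gamma> * t)\<^sup>2 * (1 - \<gamma> * t)\<^sup>2))) (at t)"
    unfolding majorant_d1_def[abs_def]
    by (rule derivative_eq_intros refl | use assms in simp)+
  moreover have "- (2 * (1 - \<gamma> * t) * (- \<gamma>)) / ((1 - \<gamma> * t)\<^sup>2 * (1 - \<gamma> * t)\<^sup>2) = majorant_d2 \<gamma> t"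
    using assms unfolding majorant_d2_def by (simp add: divide_simps) algebra
  ultimately show ?thesis by simp
qed

lemma deriv_majorant:
  assumes "\<gamma> * t < 1"
  shows "deriv (majorant \<beta> \<gamma>) t = majorant_d1 \<gamma> t"
  by (rule DERIV_imp_deriv[OF has_derivative_majorant[OF assms]])

lemma deriv_deriv_majorant:
  assumes "\<gamma> * t < 1"
  shows "deriv (deriv (majorant \<beta> \<gamma>)) t = majorant_d2 \<gamma> t"
proof (rule DERIV_imp_deriv)
  \<comment> \<open>The outer derivative depends on \<open>deriv (majorant \<beta> \<gamma>)\<close>
    near \<open>t\<close>, so the closed form is needed on a whole neighbourhood.\<close>
  have "open {s. \<gamma> * s < 1}" by (intro open_Collect_less continuous_intros)
  then have "\<forall>\<^sub>F s in nhds t. \<gamma> * s < 1"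
    using assms by (auto dest: eventually_nhds_in_open)
  then have "\<forall>\<^sub>F s in nhds t. majorant_d1 \<gamma> s = deriv (majorant \<beta> \<gamma>) s"
    by eventually_elim (simp add: deriv_majorant)
  then show "(deriv (majorant \<beta> \<gamma>) has_field_derivative majorant_d2 \<gamma> t) (at t)"
    using has_derivative_majorant_d1[OF assms] DERIV_cong_ev by blast
qed

lemma majorant_d1_mono:
  assumes "0 \<le> \<gamma>" "s \<le> t" "\<gamma> * t < 1"
  shows "majorant_d1 \<gamma> s \<le> majorant_d1 \<gamma> t"
  unfolding majorant_d1_def using assms mult_left_mono[of s t \<gamma>]
  by (auto intro!: divide_left_mono power_mono)

lemma majorant_d2_mono:
  assumes "0 \<le> \<gamma>" "s \<le> t" "\<gamma> * t < 1"
  shows "majorant_d2 \<gamma> s \<le> majorant_d2 \<gamma> t"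
  unfolding majorant_d2_def using assms mult_left_mono[of s t \<gamma>]
  by (auto intro!: divide_left_mono power_mono)

lemma convex_on_majorant_d2:
  assumes "0 < \<gamma>"
  shows "convex_on {t. \<gamma> * t < 1} (majorant_d2 \<gamma>)"
proof (rule f''_ge0_imp_convex)
  show "convex {t. \<gamma> * t < 1}"
    using convex_halfspace_lt[of \<gamma> 1] by simp
  fix t assume "t \<in> {t. \<gamma> * t < 1}"
  then have w: "1 - \<gamma> * t > 0" by simp
  show "(majorant_d2 \<gamma> has_real_derivative 6 * \<gamma>\<^sup>2 / (1 - \<gamma> * t) ^ 4) (at t)"
    unfolding majorant_d2_def[abs_def] using w
    by (auto intro!: derivative_eq_intros simp: divide_simps) algebra
  show "((\<lambda>t. 6 * \<gamma>\<^sup>2 / (1 - \<gamma> * t) ^ 4) has_real_derivative 24 * \<gamma> ^ 3 / (1 - \<gamma> * t) ^ 5) (at t)"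
    using w by (auto intro!: derivative_eq_intros simp: divide_simps) algebra
  show "0 \<le> 24 * \<gamma> ^ 3 / (1 - \<gamma> * t) ^ 5"
    using w assms by simp
qed

text \<open>Convexity is used twice: the increment over the fraction \<open>l\<close> of a step is
  at most \<open>l\<close> times the full increment, and the increment over a step of fixed length
  \<open>d\<close> grows when its base point moves right from \<open>p\<close> to
  \<open>\<tau>\<close>.\<close>

lemma majorant_d2_increment_le:
  assumes \<gamma>: "0 < \<gamma>" and "p \<le> \<tau>" "0 \<le> d" "0 \<le> l" "l \<le> 1" "\<gamma> * (\<tau> + d) < 1"
  shows "majorant_d2 \<gamma> (p + l * d) - majorant_d2 \<gamma> p \<le> l * (majorant_d2 \<gamma> (\<tau> + d) - majorant_d2 \<gamma> \<tau>)"
proof -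
  let ?g = "majorant_d2 \<gamma>" and ?S = "{t. \<gamma> * t < 1}"
  have "\<gamma> * \<tau> \<le> \<gamma> * (\<tau> + d)" "\<gamma> * p \<le> \<gamma> * \<tau>" "\<gamma> * (p + d) \<le> \<gamma> * (\<tau> + d)"
    using assms by (simp_all add: mult_left_mono)
  then have in_S: "p \<in> ?S" "\<tau> \<in> ?S" "p + d \<in> ?S" "\<tau> + d \<in> ?S"
    unfolding mem_Collect_eq using assms by linarith+
  note cvx = convex_onD[OF convex_on_majorant_d2[OF \<gamma>]]
  have "?g ((1 - l) *\<^sub>R p + l *\<^sub>R (p + d)) \<le> (1 - l) * ?g p + l * ?g (p + d)"
    using in_S assms by (intro cvx) auto
  then have 1: "?g (p + l * d) - ?g p \<le> l * (?g (p + d) - ?g p)"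
    by (simp add: algebra_simps)
  have 2: "?g (p + d) - ?g p \<le> ?g (\<tau> + d) - ?g \<tau>"
  proof (cases "\<tau> + d = p")
    case True
    then have "d = 0" "\<tau> = p" using assms by linarith+
    then show ?thesis by simp
  next
    case False
    \<comment> \<open>both \<open>p + d\<close> and \<open>\<tau>\<close> are convex combinations of \<open>p\<close> and \<open>\<tau> + d\<close>, with weights that sum to 1\<close>
    define m where "m = d / (\<tau> + d - p)"
    have pos: "\<tau> + d - p > 0" using False assms by linarith
    have m: "0 \<le> m" "m \<le> 1" using pos assms unfolding m_def by (auto simp: divide_simps)
    have md: "m * (\<tau> + d - p) = d" using pos unfolding m_def by simp
    have "?g ((1 - m) *\<^sub>R p + m *\<^sub>R (\<tau> + d)) \<le> (1 - m) * ?g p + m * ?g (\<tau> + d)"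
      "?g ((1 - (1 - m)) *\<^sub>R p + (1 - m) *\<^sub>R (\<tau> + d)) \<le> (1 - (1 - m)) * ?g p + (1 - m) * ?g (\<tau> + d)"
      using in_S m by (intro cvx; simp)+
    moreover have "(1 - m) *\<^sub>R p + m *\<^sub>R (\<tau> + d) = p + d"
      "(1 - (1 - m)) *\<^sub>R p + (1 - m) *\<^sub>R (\<tau> + d) = \<tau>"
      using md by (simp_all add: algebra_simps)
    ultimately show ?thesis by (simp add: algebra_simps)
  qed
  show ?thesis using 1 mult_left_mono[OF 2 \<open>0 \<le> l\<close>] by linarith
qed

section \<open>The scalar Halley iteration, solved explicitly\<close>

locale halley_majorant =
  fixes \<beta> \<gamma> ts tss :: real
  assumes \<beta>_pos: "0 < \<beta>" and \<gamma>_pos: "0 < \<gamma>"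
    and small: "\<beta> * \<gamma> < 3 - 2 * sqrt 2"
    and ts_eq: "ts = (1 + \<beta> * \<gamma> - sqrt ((1 + \<beta> * \<gamma>)\<^sup>2 - 8 * (\<beta> * \<gamma>))) / (4 * \<gamma>)"
    and tss_eq: "tss = (1 + \<beta> * \<gamma> + sqrt ((1 + \<beta> * \<gamma>)\<^sup>2 - 8 * (\<beta> * \<gamma>))) / (4 * \<gamma>)"
begin

definition "wa = 1 - \<gamma> * ts"
definition "wb = 1 - \<gamma> * tss"

text \<open>Vieta's formulas: in \<open>w = 1 - \<gamma> * t\<close> the majorant times
  \<open>\<gamma>\<close> is \<open>(2 * w\<^sup>2 - (3 - \<beta> * \<gamma>) * w + 1) / w\<close>,
  with zeros \<open>wa\<close> and \<open>wb\<close>. The bound \<open>wa_sq\<close> expresses that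
  the derivative of the majorant is still negative at \<open>ts\<close>.\<close>

lemma roots:
  shows wa_wb: "2 * (wa * wb) = 1" and wa_plus_wb: "2 * (wa + wb) = 3 - \<beta> * \<gamma>"
    and wb_pos: "0 < wb" and wb_less: "wb < wa" and wa_less: "wa < 1"
    and wa_sq: "1 < 2 * wa\<^sup>2"
proof -
  define a where "a = \<beta> * \<gamma>"
  define d where "d = sqrt ((1 + a)\<^sup>2 - 8 * a)"
  have a: "0 < a" "a < 3 - 2 * sqrt 2" using \<beta>_pos \<gamma>_pos small by (simp_all add: a_def)
  have a': "a < 3" using a(2) real_sqrt_gt_zero[of 2] by linarith
  \<comment> \<open>The discriminant \<open>a\<^sup>2 - 6 * a + 1\<close> has the zeros
    \<open>3 - 2 * sqrt 2\<close> and \<open>3 + 2 * sqrt 2\<close>; the smallness hypothesis puts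
    \<open>a\<close> below both.\<close>
  have "0 < (3 - 2 * sqrt 2 - a) * (3 + 2 * sqrt 2 - a)"
    using a a' real_sqrt_gt_zero[of 2] by (intro mult_pos_pos) linarith+
  also have "\<dots> = (1 + a)\<^sup>2 - 8 * a"
    by (simp add: algebra_simps power2_eq_square)
  finally have d: "0 < d" "d\<^sup>2 = (1 + a)\<^sup>2 - 8 * a" unfolding d_def by simp_all
  have w: "4 * wa = 3 - a + d" "4 * wb = 3 - a - d"
  proof -
    have "\<gamma> * ts = (1 + a - d) / 4" "\<gamma> * tss = (1 + a + d) / 4"
      using \<gamma>_pos by (simp_all add: ts_eq tss_eq a_def[symmetric] d_def[symmetric])
    then show "4 * wa = 3 - a + d" "4 * wb = 3 - a - d"
      by (simp_all add: wa_def wb_def)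
  qed
  have "16 * (wa * wb) = (4 * wa) * (4 * wb)" by simp
  also have "\<dots> = (3 - a)\<^sup>2 - d\<^sup>2" unfolding w by (simp add: algebra_simps power2_eq_square)
  also have "\<dots> = 8" unfolding d(2) by (simp add: algebra_simps power2_eq_square)
  finally show 1: "2 * (wa * wb) = 1" by simp
  show "2 * (wa + wb) = 3 - \<beta> * \<gamma>" using w by (simp add: a_def)
  have wa: "0 < wa" using w a' d by linarith
  then show wb: "0 < wb" using 1 by (metis mult_pos_pos zero_less_mult_pos zero_less_numeral zero_less_one)
  show less: "wb < wa" using w d by linarith
  have "d\<^sup>2 < (1 + a)\<^sup>2" using d a by simp
  then have "d < 1 + a" using a by (intro power2_less_imp_less[of d]) auto
  then show "wa < 1" using w by linarith
  show "1 < 2 * wa\<^sup>2" using 1 mult_strict_left_mono[OF less wa] by (simp add: power2_eq_square)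
qed

lemma ts_pos: "0 < ts" and ts_less: "ts < tss" and \<gamma>_tss: "\<gamma> * tss < 1"
proof -
  have "0 < \<gamma> * ts" using wa_less by (simp add: wa_def)
  then show "0 < ts" using \<gamma>_pos zero_less_mult_pos by blast
  have "\<gamma> * ts < \<gamma> * tss" using wb_less by (simp add: wa_def wb_def)
  then show "ts < tss" using \<gamma>_pos by simp
  show "\<gamma> * tss < 1" using wb_pos by (simp add: wb_def)
qed

lemma \<gamma>_times_less_1: "\<gamma> * t < 1" if "t \<le> ts"
  using mult_left_mono[OF that, of \<gamma>] mult_strict_left_mono[OF ts_less, of \<gamma>] \<gamma>_tss \<gamma>_pos by linarith

lemma majorant_factor:
  assumes "\<gamma> * t < 1"
  shows "majorant \<beta> \<gamma> t = 2 * \<gamma> * (ts - t) * (tss - t) / (1 - \<gamma> * t)"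
proof -
  \<comment> \<open>The relations between \<open>wa\<close> and \<open>wb\<close> turn into the sum
    and the product of the zeros \<open>ts\<close> and \<open>tss\<close>.\<close>
  have "2 * (\<gamma> * ts + \<gamma> * tss) = 1 + \<beta> * \<gamma>"
    using wa_plus_wb by (simp add: wa_def wb_def)
  moreover have "2 * ((\<gamma> * ts) * (\<gamma> * tss)) = \<beta> * \<gamma>"
    using wa_wb calculation by (simp add: wa_def wb_def algebra_simps)
  then have "2 * \<gamma> * (ts * tss) = \<beta>" using \<gamma>_pos by (simp add: ac_simps)
  ultimately show ?thesis
    using assms unfolding majorant_def by (simp add: divide_simps) algebra
qed

lemma majorant_ts: "majorant \<beta> \<gamma> ts = 0"
  using majorant_factor[OF \<gamma>_times_less_1] by simp

lemma majorant_neg: "majorant \<beta> \<gamma> t < 0" if "ts < t" "t < tss"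
proof -
  have "\<gamma> * t < 1" using mult_strict_left_mono[OF that(2) \<gamma>_pos] \<gamma>_tss by linarith
  then show ?thesis
    using majorant_factor[of t] that \<gamma>_pos by (simp add: divide_neg_pos mult_pos_neg mult_neg_pos)
qed

text \<open>The derivative is \<open>1 / w\<^sup>2 - 2\<close> with
  \<open>w = 1 - \<gamma> * t\<close>, hence negative once \<open>1 < 2 * w\<^sup>2\<close>; by
  \<open>wa_sq\<close> this holds at \<open>wa\<close>, and therefore at every larger
  \<open>w\<close>.\<close>

lemma majorant_d1_neg: "majorant_d1 \<gamma> t < 0" if "t \<le> ts"
proof -
  have "wa \<le> 1 - \<gamma> * t" using mult_left_mono[OF that, of \<gamma>] \<gamma>_pos by (simp add: wa_def)
  moreover have "0 < wa" using wb_pos wb_less by linarith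
  ultimately have "wa\<^sup>2 \<le> (1 - \<gamma> * t)\<^sup>2" by (intro power_mono) auto
  then have "1 < 2 * (1 - \<gamma> * t)\<^sup>2" using wa_sq by linarith
  then show ?thesis unfolding majorant_d1_def by (simp add: divide_simps)
qed

lemma majorant_d2_pos: "0 < majorant_d2 \<gamma> t" if "\<gamma> * t < 1"
  using that \<gamma>_pos by (simp add: majorant_d2_def)

definition "step t = t - 1 / (1 - scalar_halley_L (majorant \<beta> \<gamma>) t) *
  (majorant \<beta> \<gamma> t / deriv (majorant \<beta> \<gamma>) t)"

lemma scalar_halley_L_majorant:
  assumes "\<gamma> * t < 1"
  shows "scalar_halley_L (majorant \<beta> \<gamma>) t =
    majorant \<beta> \<gamma> t * majorant_d2 \<gamma> t / (2 * (majorant_d1 \<gamma> t)\<^sup>2)"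
  using assms by (simp add: scalar_halley_L_def deriv_majorant deriv_deriv_majorant)

text \<open>The denominator of Halley's map for the majorant, written in \<open>w = 1 - \<gamma> t\<close>.\<close>

definition "den w = 4 * w ^ 3 - 6 * w + 2 * (wa + wb)"

text \<open>The difference factors as \<open>w - v\<close> times
  \<open>4 * (w * w + w * v + v * v) - 6\<close>, and each of the three products is at least
  \<open>wa\<^sup>2\<close>, which exceeds one half.\<close>

lemma den_mono:
  assumes "wa \<le> v" "v \<le> w"
  shows "den v \<le> den w"
proof -
  have "0 < wa" using wb_pos wb_less by linarith
  have "wa * wa \<le> v * v" "wa * wa \<le> w * v" "wa * wa \<le> w * w"
    using assms \<open>0 < wa\<close> by (intro mult_mono; linarith)+
  then have "0 \<le> (w - v) * (4 * (w * w + w * v + v * v) - 6)"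
    using assms wa_sq by (intro mult_nonneg_nonneg) (auto simp: power2_eq_square)
  also have "\<dots> = den w - den v" by (simp add: den_def algebra_simps power3_eq_cube)
  finally show ?thesis by simp
qed

lemma den_wa: "den wa = 2 * wb * (2 * wa\<^sup>2 - 1)\<^sup>2"
  using wa_wb unfolding den_def by algebra

lemma den_1: "den 1 < 1"
  using wa_plus_wb \<beta>_pos \<gamma>_pos by (simp add: den_def)

lemma den_pos: "0 < den w" if "wa \<le> w"
proof -
  have "0 < den wa" unfolding den_wa using wa_sq wb_pos by simp
  then show ?thesis using den_mono[OF order_refl that] by linarith
qed

text \<open>Everything is rewritten as a rational function of \<open>w\<close>. The third claim
  yields a uniform linear rate, the fourth the exact cubic law.\<close>

lemma scalar_step:
  assumes "0 \<le> t" "t < ts"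
  defines "w \<equiv> 1 - \<gamma> * t"
  shows "0 \<le> scalar_halley_L (majorant \<beta> \<gamma>) t"
    and "scalar_halley_L (majorant \<beta> \<gamma>) t < 1"
    and "ts - step t = (ts - t) * (1 - 2 * (w - wb) * (2 * w\<^sup>2 - 1) / den w)"
    and "ts - step t = 4 * wb * \<gamma>\<^sup>2 / den w * (ts - t) ^ 3"
proof -
  let ?f = "majorant \<beta> \<gamma>"
  let ?L = "scalar_halley_L ?f t"
  have \<gamma>t: "\<gamma> * t < 1" using \<gamma>_times_less_1[of t] assms by simp
  have w: "wa < w" using assms(2) \<gamma>_pos by (simp add: w_def wa_def)
  have "0 < wa" using wb_pos wb_less by linarith
  have w2: "1 < 2 * w\<^sup>2" using wa_sq power_strict_mono[OF w, of 2] \<open>0 < wa\<close> by simp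
  have wpos: "0 < w" using w \<open>0 < wa\<close> by simp
  note den = den_pos[OF less_imp_le[OF w]]
  have tt: "\<gamma> * (ts - t) = w - wa" "\<gamma> * (tss - t) = w - wb"
    by (simp_all add: w_def wa_def wb_def algebra_simps)
  have "?f t = 2 * (\<gamma> * (ts - t)) * (\<gamma> * (tss - t)) / (\<gamma> * w)"
    using \<gamma>_pos by (simp add: majorant_factor[OF \<gamma>t] w_def)
  then have f: "?f t = 2 * (w - wa) * (w - wb) / (\<gamma> * w)" unfolding tt .
  have f1: "majorant_d1 \<gamma> t = - (2 * w\<^sup>2 - 1) / w\<^sup>2"
    unfolding majorant_d1_def w_def[symmetric] using wpos by (simp add: field_simps)
  have L: "?L = 2 * (w - wa) * (w - wb) / (2 * w\<^sup>2 - 1)\<^sup>2"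
  proof -
    have "(2 * w\<^sup>2 - 1) \<noteq> 0" using w2 by simp
    then show ?thesis
      unfolding scalar_halley_L_majorant[OF \<gamma>t] f f1 majorant_d2_def w_def[symmetric]
      using wpos \<gamma>_pos by (simp add: divide_simps power2_eq_square power3_eq_cube)
        (simp add: algebra_simps)
  qed
  then show "0 \<le> ?L" using w wb_less by simp
  \<comment> \<open>The factor \<open>w\<close> splits off because the constant term
    \<open>1 - 2 * wa * wb\<close> vanishes.\<close>
  have id: "(2 * w\<^sup>2 - 1)\<^sup>2 - 2 * (w - wa) * (w - wb) = w * den w"
    using wa_wb unfolding den_def by algebra
  have L': "1 - ?L = w * den w / (2 * w\<^sup>2 - 1)\<^sup>2"
    unfolding L id[symmetric] using w2 by (simp add: diff_divide_distrib)
  then have "0 < 1 - ?L" using wpos den w2 by simp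
  then show "?L < 1" by simp
  have "step t = t + 2 * (w - wa) * (w - wb) * (2 * w\<^sup>2 - 1) / (\<gamma> * den w)"
  proof -
    have "(2 * w\<^sup>2 - 1) \<noteq> 0" using w2 by simp
    then show ?thesis
      unfolding step_def L' deriv_majorant[OF \<gamma>t] f f1
      using wpos \<gamma>_pos den
      by (simp add: divide_simps power2_eq_square) (simp add: algebra_simps)
  qed
  also have "2 * (w - wa) * (w - wb) * (2 * w\<^sup>2 - 1) / (\<gamma> * den w)
      = (ts - t) * (2 * (w - wb) * (2 * w\<^sup>2 - 1) / den w)"
    unfolding tt[symmetric] using \<gamma>_pos den by (simp add: divide_simps)
  finally show 1: "ts - step t = (ts - t) * (1 - 2 * (w - wb) * (2 * w\<^sup>2 - 1) / den w)"
    by (simp add: algebra_simps)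
  \<comment> \<open>Source of the cubic order: thanks to \<open>2 * wa * wb = 1\<close> the
    numerator of the relative error is a multiple of the square of \<open>w - wa\<close>.\<close>
  have "den w - 2 * (w - wb) * (2 * w\<^sup>2 - 1) = 4 * wb * (w - wa)\<^sup>2"
    using wa_wb unfolding den_def by algebra
  then have "1 - 2 * (w - wb) * (2 * w\<^sup>2 - 1) / den w = 4 * wb * (w - wa)\<^sup>2 / den w"
    using den by (simp add: divide_simps)
  then show "ts - step t = 4 * wb * \<gamma>\<^sup>2 / den w * (ts - t) ^ 3"
    unfolding 1 tt(1)[symmetric] by (simp add: power_mult_distrib power3_eq_cube power2_eq_square)
qed

text \<open>Since \<open>den w\<close> lies in the interval from 0 to 1, dividing by it only helps;
  the remaining product is smallest at \<open>w = wa\<close>. This gives one contraction factor for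
  all \<open>t\<close>, enough for convergence to \<open>ts\<close>.\<close>

lemma step_le_rate:
  assumes "0 \<le> t" "t < ts"
  shows "ts - step t \<le> (1 - 2 * (wa - wb) * (2 * wa\<^sup>2 - 1)) * (ts - t)"
proof -
  define w where "w = 1 - \<gamma> * t"
  have w: "wa < w" "w \<le> 1" using assms \<gamma>_pos by (simp_all add: w_def wa_def)
  have "0 < wa" using wb_pos wb_less by linarith
  note den = den_pos[OF less_imp_le[OF w(1)]]
  have "den w \<le> 1" using den_mono[of w 1] w den_1 by linarith
  have "wa\<^sup>2 \<le> w\<^sup>2" using w \<open>0 < wa\<close> by (intro power_mono) auto
  then have "2 * (wa - wb) * (2 * wa\<^sup>2 - 1) \<le> 2 * (w - wb) * (2 * w\<^sup>2 - 1)"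
    using w wa_sq wb_less by (intro mult_mono) auto
  also have "\<dots> \<le> 2 * (w - wb) * (2 * w\<^sup>2 - 1) / den w"
  proof -
    have "0 \<le> 2 * (w - wb) * (2 * w\<^sup>2 - 1)"
      using w wa_sq wb_less \<open>wa\<^sup>2 \<le> w\<^sup>2\<close> by (intro mult_nonneg_nonneg) auto
    then show ?thesis using den \<open>den w \<le> 1\<close> by (simp add: le_divide_eq_1 pos_le_divide_eq mult_left_le)
  qed
  finally show ?thesis
    using scalar_step(3)[OF assms, folded w_def] assms
    by (simp add: mult.commute[of "ts - t"] mult_right_mono)
qed

text \<open>The first bound holds because the contraction factor is below 1, the second because the
  exact cubic error formula has a positive right-hand side.\<close>

lemma step_bounds:
  assumes "0 \<le> t" "t < ts"
  shows "t < step t" "step t < ts"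
proof -
  have "0 < 2 * (wa - wb) * (2 * wa\<^sup>2 - 1)" using wb_less wa_sq by simp
  then have "(1 - 2 * (wa - wb) * (2 * wa\<^sup>2 - 1)) * (ts - t) < 1 * (ts - t)"
    using assms by (intro mult_strict_right_mono) auto
  then have "ts - step t < 1 * (ts - t)" using step_le_rate[OF assms] by (rule order.strict_trans1[rotated])
  then show "t < step t" by simp
  have "wa \<le> 1 - \<gamma> * t" using assms \<gamma>_pos by (simp add: wa_def)
  then have "0 < 4 * wb * \<gamma>\<^sup>2 / den (1 - \<gamma> * t) * (ts - t) ^ 3"
    using assms wb_pos \<gamma>_pos den_pos by simp
  then show "step t < ts" using scalar_step(4)[OF assms] by simp
qed

text \<open>By monotonicity of \<open>den\<close> the factor in the exact error formula is largest
  at \<open>wa\<close>, where \<open>den_wa\<close> makes \<open>wb\<close> cancel.\<close>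

lemma step_cubic:
  assumes "0 \<le> t" "t < ts"
  shows "ts - step t \<le> 2 * \<gamma>\<^sup>2 / (2 * wa\<^sup>2 - 1)\<^sup>2 * (ts - t) ^ 3"
proof -
  have w: "wa \<le> 1 - \<gamma> * t" using assms \<gamma>_pos by (simp add: wa_def)
  have "4 * wb * \<gamma>\<^sup>2 / den (1 - \<gamma> * t) \<le> 4 * wb * \<gamma>\<^sup>2 / den wa"
    using w den_pos[OF order_refl] den_pos[OF w] den_mono[OF order_refl w] wb_pos
    by (intro divide_left_mono mult_pos_pos) auto
  also have "\<dots> = 2 * \<gamma>\<^sup>2 / (2 * wa\<^sup>2 - 1)\<^sup>2"
    unfolding den_wa using wb_pos wa_sq by (simp add: divide_simps)
  finally show ?thesis
    unfolding scalar_step(4)[OF assms] using assms by (intro mult_right_mono) auto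
qed

definition "tk k = scalar_halley_seq (majorant \<beta> \<gamma>) 0 k"

lemma tk_0: "tk 0 = 0" and tk_Suc: "tk (Suc k) = step (tk k)"
  by (simp_all add: tk_def step_def Let_def)

lemma tk_bounds: "0 \<le> tk k" "tk k < ts"
proof -
  have "0 \<le> tk k \<and> tk k < ts"
  proof (induction k)
    case (Suc k)
    then show ?case using step_bounds[of "tk k"] by (simp add: tk_Suc)
  qed (simp add: tk_0 ts_pos)
  then show "0 \<le> tk k" "tk k < ts" by auto
qed

lemma tk_tendsto: "tk \<longlonglongrightarrow> ts"
proof -
  define q where "q = 1 - 2 * (wa - wb) * (2 * wa\<^sup>2 - 1)"
  have "q < 1" using wb_less wa_sq by (simp add: q_def)
  \<comment> \<open>The very first step leaves a positive error of at most \<open>q * ts\<close>,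
    which forces \<open>q\<close> to be positive.\<close>
  have "0 < q * ts"
    using step_le_rate[of 0] step_bounds(2)[of 0] ts_pos by (simp add: q_def)
  then have "0 < q" using ts_pos zero_less_mult_pos2 by blast
  have le: "ts - tk k \<le> q ^ k * ts" for k
  proof (induction k)
    case (Suc k)
    have "ts - tk (Suc k) \<le> q * (ts - tk k)"
      using step_le_rate[OF tk_bounds, of k] by (simp add: tk_Suc q_def)
    also have "\<dots> \<le> q * (q ^ k * ts)" using Suc \<open>0 < q\<close> by (intro mult_left_mono) auto
    finally show ?case by simp
  qed (simp add: tk_0)
  have "(\<lambda>k. q ^ k * ts) \<longlonglongrightarrow> 0 * ts"
    using \<open>0 < q\<close> \<open>q < 1\<close> by (intro tendsto_mult LIMSEQ_power_zero tendsto_const) auto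
  then have "(\<lambda>k. q ^ k * ts) \<longlonglongrightarrow> 0" by simp
  then have "(\<lambda>k. ts - tk k) \<longlonglongrightarrow> 0"
    by (rule tendsto_sandwich[OF _ _ tendsto_const, rotated 2])
      (use le tk_bounds(2) in \<open>auto intro!: always_eventually less_imp_le\<close>)
  then have "(\<lambda>k. ts - (ts - tk k)) \<longlonglongrightarrow> ts - 0" by (intro tendsto_diff tendsto_const)
  then show ?thesis by simp
qed

section \<open>Scalar identities that the operator estimates will mirror\<close>

definition "remainder t e =
  majorant \<beta> \<gamma> (t + e) - majorant \<beta> \<gamma> t - majorant_d1 \<gamma> t * e - majorant_d2 \<gamma> t * e\<^sup>2 / 2"

text \<open>The second derivative of the majorant is increasing; integrating its increment twice,
  first to \<open>h\<close> and then to \<open>k\<close>, keeps the sign.\<close>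

lemma remainder_nonneg:
  assumes "0 < e" "\<gamma> * (t + e) < 1"
  shows "0 \<le> remainder t e"
proof -
  have le: "\<gamma> * s < 1" if "s \<le> t + e" for s
    using mult_left_mono[OF that, of \<gamma>] \<gamma>_pos assms by linarith
  define h where "h s = majorant_d1 \<gamma> s - majorant_d1 \<gamma> t - majorant_d2 \<gamma> t * (s - t)" for s
  have "0 \<le> h s" if "t \<le> s" "s \<le> t + e" for s
  proof -
    have "h t \<le> h s"
    proof (rule DERIV_nonneg_imp_nondecreasing[OF that(1)])
      fix y assume y: "t \<le> y" "y \<le> s"
      have "(h has_real_derivative majorant_d2 \<gamma> y - majorant_d2 \<gamma> t) (at y)"
        unfolding h_def[abs_def] using has_derivative_majorant_d1[OF le, of y] y that
        by (auto intro!: derivative_eq_intros)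
      then show "\<exists>d. (h has_real_derivative d) (at y) \<and> 0 \<le> d"
        using majorant_d2_mono[of \<gamma> t y] le[of y] y that \<gamma>_pos by auto
    qed
    then show ?thesis by (simp add: h_def)
  qed
  note h = this
  define k where
    "k s = majorant \<beta> \<gamma> s - majorant_d1 \<gamma> t * (s - t) - majorant_d2 \<gamma> t * (s - t)\<^sup>2 / 2" for s
  have "k t \<le> k (t + e)"
  proof (rule DERIV_nonneg_imp_nondecreasing[where a = t and b = "t + e" and f = k])
    fix y assume y: "t \<le> y" "y \<le> t + e"
    have "(k has_real_derivative h y) (at y)"
      unfolding h_def k_def[abs_def] using has_derivative_majorant[OF le[OF y(2)]]
      by (auto intro!: derivative_eq_intros)
    then show "\<exists>d. (k has_real_derivative d) (at y) \<and> 0 \<le> d" using h[OF y] by auto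
  qed (use assms in simp)
  then show ?thesis by (simp add: remainder_def k_def)
qed

lemma step_minus:
  assumes "0 \<le> t" "t < ts"
  shows "(1 - scalar_halley_L (majorant \<beta> \<gamma>) t) * (step t - t) = - majorant \<beta> \<gamma> t / majorant_d1 \<gamma> t"
  using scalar_step(2)[OF assms] \<gamma>_times_less_1[of t] assms
  by (simp add: step_def deriv_majorant divide_simps)

text \<open>With f for the majorant, Halley's equation turns \<open>f t + f' t * r\<close> into
  \<open>- (1 - L) * f'' t * r\<^sup>2 / 2\<close>. This cancels the quadratic Taylor term except
  for its \<open>L\<close>-fold part.\<close>

lemma majorant_step:
  assumes "0 \<le> t" "t < ts"
  defines "L \<equiv> scalar_halley_L (majorant \<beta> \<gamma>) t" and "r \<equiv> step t - t"
  shows "majorant \<beta> \<gamma> (step t) = majorant_d2 \<gamma> t * (L * r) * r / 2 + remainder t r"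
proof -
  have neg: "majorant_d1 \<gamma> t < 0" using majorant_d1_neg[of t] assms by simp
  have "\<gamma> * t < 1" using \<gamma>_times_less_1[of t] assms by simp
  note L = scalar_halley_L_majorant[OF this, folded L_def]
  have 1: "(1 - L) * r * majorant_d1 \<gamma> t = - majorant \<beta> \<gamma> t"
    using step_minus[OF assms(1,2)] neg unfolding L_def r_def by (simp add: divide_simps)
  have 2: "2 * L * (majorant_d1 \<gamma> t)\<^sup>2 = majorant \<beta> \<gamma> t * majorant_d2 \<gamma> t"
    using neg unfolding L by simp
  have "2 * L * majorant_d1 \<gamma> t * majorant_d1 \<gamma> t
      = (- ((1 - L) * r * majorant_d2 \<gamma> t)) * majorant_d1 \<gamma> t"
    using 1 2 by algebra
  then have 3: "2 * L * majorant_d1 \<gamma> t = - ((1 - L) * r * majorant_d2 \<gamma> t)"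
    using neg by (metis mult_right_cancel less_irrefl)
  have "t + r = step t" by (simp add: r_def)
  moreover have "2 * (majorant_d1 \<gamma> t * r) = - 2 * majorant \<beta> \<gamma> t - (1 - L) * r * majorant_d2 \<gamma> t * r"
    using 1 arg_cong[OF 3, of "\<lambda>u. u * r"] by (simp add: algebra_simps)
  ultimately show ?thesis unfolding remainder_def by (simp add: field_simps power2_eq_square)
qed

text \<open>The value \<open>v\<close> of \<open>(1 - L) * (step t - t)\<close> is the Newton
  correction, and \<open>L = v * c / 2\<close>. Dividing by the positive number
  \<open>- majorant_d1 \<gamma> t\<close> makes \<open>c\<close> and \<open>R\<close> nonnegative,
  so the right-hand side can serve as a bound for norms.\<close>

lemma error_identity:
  assumes "0 \<le> t" "t < ts"
  defines "L \<equiv> scalar_halley_L (majorant \<beta> \<gamma>) t" and "e \<equiv> ts - t"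
    and "c \<equiv> majorant_d2 \<gamma> t / - majorant_d1 \<gamma> t"
    and "R \<equiv> remainder t (ts - t) / - majorant_d1 \<gamma> t"
  shows "(1 - L) * (ts - step t) = c * (c * e ^ 2 / 2 + R) * e / 2 + R"
proof -
  define p where "p = - majorant_d1 \<gamma> t"
  define f where "f = majorant \<beta> \<gamma> t"
  have neg: "0 < p" using majorant_d1_neg[of t] assms by (simp add: p_def)
  have "\<gamma> * t < 1" using \<gamma>_times_less_1[of t] assms by simp
  note L0 = scalar_halley_L_majorant[OF this, folded L_def]
  have cp: "majorant_d2 \<gamma> t = c * p" using neg by (simp add: c_def p_def)
  define v where "v = f / p"
  have step: "(1 - L) * (step t - t) = v"
    using step_minus[OF assms(1,2)] neg unfolding L_def by (simp add: v_def f_def p_def)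
  \<comment> \<open>This is the Taylor expansion of the majorant at \<open>t\<close>, evaluated at
    its zero \<open>ts\<close>.\<close>
  have v: "v = e - c * e\<^sup>2 / 2 - R"
  proof -
    have "R * p = - f + p * e - c * p * e\<^sup>2 / 2"
      using neg majorant_ts cp unfolding R_def remainder_def p_def f_def e_def by simp
    then have "f = (e - c * e\<^sup>2 / 2 - R) * p" by (simp add: algebra_simps)
    then show ?thesis using neg by (simp add: v_def)
  qed
  have L: "L = v * c / 2"
    using neg unfolding L0 cp f_def[symmetric] by (simp add: v_def p_def power2_eq_square divide_simps)
  have "(1 - L) * (ts - step t) = e - L * e - (1 - L) * (step t - t)"
    by (simp add: e_def algebra_simps)
  also have "\<dots> = (e - v) - v * c / 2 * e" unfolding step unfolding L by simp
  also have "\<dots> = c * (c * e ^ 2 / 2 + R) * e / 2 + R"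
    unfolding v by (simp add: field_simps power2_eq_square)
  finally show ?thesis .
qed

end

section \<open>The normalised operator: bounds on derivatives and Taylor remainder\<close>

lemma has_vector_derivative_along_line:
  assumes "(g has_derivative g') (at (x + s *\<^sub>R e))"
  shows "((\<lambda>s. g (x + s *\<^sub>R e)) has_vector_derivative g' e) (at s)"
proof -
  have "((\<lambda>s. x + s *\<^sub>R e) has_vector_derivative e) (at s)"
    by (auto intro!: derivative_eq_intros)
  then show ?thesis
    using vector_derivative_diff_chain_within[of "\<lambda>s. x + s *\<^sub>R e" e s UNIV g g'] assms
    by (simp add: o_def has_derivative_at_withinI)
qed

lemma norm_blinfun2:
  "norm (blinfun_apply (blinfun_apply B u) v) \<le> norm B * norm u * norm v"
  using norm_blinfun[of "blinfun_apply B u" v] mult_right_mono[OF norm_blinfun[of B u] norm_ge_zero[of v]]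
  by linarith

text \<open>Here \<open>G\<close> stands for \<open>F\<close> composed with the inverse of
  \<open>F' x0\<close>, and the hypotheses concern only the ball of radius
  \<open>1 / \<gamma>\<close>: the distance condition in \<open>G''_diff\<close> already places
  \<open>u\<close> and \<open>v\<close> in it.\<close>

locale halley_operator = halley_majorant +
  fixes G :: "'a::banach \<Rightarrow> 'a" and G' :: "'a \<Rightarrow> 'a \<Rightarrow>\<^sub>L 'a" and G'' :: "'a \<Rightarrow> 'a \<Rightarrow>\<^sub>L 'a \<Rightarrow>\<^sub>L 'a"
    and x0 :: 'a
  assumes has_derivative_G: "norm (z - x0) < 1 / \<gamma> \<Longrightarrow> (G has_derivative blinfun_apply (G' z)) (at z)"
    and has_derivative_G': "norm (z - x0) < 1 / \<gamma> \<Longrightarrow> (G' has_derivative blinfun_apply (G'' z)) (at z)"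
    and G_x0: "norm (G x0) \<le> \<beta>"
    and G'_x0: "G' x0 = id_blinfun"
    and G''_x0: "norm (G'' x0) \<le> 2 * \<gamma>"
    and G''_diff: "norm (v - u) + norm (u - x0) < 1 / \<gamma> \<Longrightarrow>
      norm (G'' v - G'' u) \<le> majorant_d2 \<gamma> (norm (v - u) + norm (u - x0)) - majorant_d2 \<gamma> (norm (u - x0))"
begin

lemma less_inverse_iff: "t < 1 / \<gamma> \<longleftrightarrow> \<gamma> * t < 1"
  using \<gamma>_pos by (simp add: field_simps)

text \<open>The increment condition with base point \<open>x0\<close>, combined with the bound at
  \<open>x0\<close>, where \<open>2 * \<gamma>\<close> is the value of
  \<open>majorant_d2 \<gamma>\<close> at 0.\<close>

lemma norm_G'':
  assumes "norm (x - x0) \<le> t" "\<gamma> * t < 1"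
  shows "norm (G'' x) \<le> majorant_d2 \<gamma> t"
proof -
  have lt: "norm (x - x0) < 1 / \<gamma>" using assms less_inverse_iff[of t] by linarith
  have "norm (G'' x) \<le> norm (G'' x - G'' x0) + norm (G'' x0)"
    using norm_triangle_ineq[of "G'' x - G'' x0" "G'' x0"] by simp
  also have "\<dots> \<le> (majorant_d2 \<gamma> (norm (x - x0)) - majorant_d2 \<gamma> 0) + 2 * \<gamma>"
    using G''_diff[of x x0] G''_x0 lt by (intro add_mono) simp_all
  also have "\<dots> = majorant_d2 \<gamma> (norm (x - x0))" by (simp add: majorant_d2_def)
  also have "\<dots> \<le> majorant_d2 \<gamma> t" using assms \<gamma>_pos by (intro majorant_d2_mono) auto
  finally show ?thesis .
qed

text \<open>The bound on \<open>G''\<close> is integrated along the segment from \<open>x0\<close>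
  to \<open>x\<close>; the summand 1 appears because
  \<open>majorant_d1 \<gamma> 0 = -1\<close>.\<close>

lemma norm_id_minus_G':
  assumes "norm (x - x0) \<le> t" "\<gamma> * t < 1"
  shows "norm (id_blinfun - G' x) \<le> 1 + majorant_d1 \<gamma> t"
proof -
  define n where "n = norm (x - x0)"
  have n: "\<gamma> * n < 1" using assms less_inverse_iff by (metis n_def order.strict_trans1)
  have sn: "norm (x0 + s *\<^sub>R (x - x0) - x0) = s * n" "s * n \<le> n" "\<gamma> * (s * n) < 1"
    if "0 \<le> s" "s \<le> 1" for s
  proof -
    show 1: "norm (x0 + s *\<^sub>R (x - x0) - x0) = s * n" using that by (simp add: n_def)
    show 2: "s * n \<le> n" using that by (simp add: n_def mult_left_le_one_le)
    show "\<gamma> * (s * n) < 1" using mult_left_mono[OF 2, of \<gamma>] \<gamma>_pos n by linarith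
  qed
  let ?f = "\<lambda>s. G' (x0 + s *\<^sub>R (x - x0))" and ?\<phi> = "\<lambda>s. majorant_d1 \<gamma> (s * n)"
  have f: "(?f has_vector_derivative G'' (x0 + s *\<^sub>R (x - x0)) (x - x0)) (at s)"
    if "0 \<le> s" "s \<le> 1" for s
    by (rule has_vector_derivative_along_line[OF has_derivative_G'])
      (simp only: sn[OF that] less_inverse_iff)
  have \<phi>: "(?\<phi> has_vector_derivative majorant_d2 \<gamma> (s * n) * n) (at s)"
    if "0 \<le> s" "s \<le> 1" for s
    unfolding has_real_derivative_iff_has_vector_derivative[symmetric]
  proof -
    have "((\<lambda>s. s * n) has_real_derivative n) (at s)" by (auto intro!: derivative_eq_intros)
    then show "((\<lambda>s. majorant_d1 \<gamma> (s * n)) has_real_derivative majorant_d2 \<gamma> (s * n) * n) (at s)"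
      using DERIV_chain'[of "\<lambda>s. s * n" n s UNIV] has_derivative_majorant_d1[OF sn(3)[OF that]]
      by blast
  qed
  have "norm (?f 1 - ?f 0) \<le> ?\<phi> 1 - ?\<phi> 0"
  proof (rule differentiable_bound_general)
    show "continuous_on {0..1} ?f" "continuous_on {0..1} ?\<phi>"
      by (auto intro!: continuous_at_imp_continuous_on
          intro: has_vector_derivative_continuous[OF f] has_vector_derivative_continuous[OF \<phi>])
    fix s :: real assume "0 < s" "s < 1"
    then have s: "0 \<le> s" "s \<le> 1" by auto
    show "norm (G'' (x0 + s *\<^sub>R (x - x0)) (x - x0)) \<le> majorant_d2 \<gamma> (s * n) * n"
    proof -
      have "norm (G'' (x0 + s *\<^sub>R (x - x0))) \<le> majorant_d2 \<gamma> (s * n)"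
        using sn[OF s] by (intro norm_G'') (simp_all only: order_refl)
      then show ?thesis
        unfolding n_def[symmetric] using norm_blinfun[of "G'' (x0 + s *\<^sub>R (x - x0))" "x - x0"]
          mult_right_mono[of _ _ n] unfolding n_def by (meson norm_ge_zero order.trans)
    qed
  qed (use f \<phi> in auto)
  then have "norm (id_blinfun - G' x) \<le> 1 + majorant_d1 \<gamma> n"
    by (simp add: G'_x0 majorant_d1_def norm_minus_commute)
  also have "\<dots> \<le> 1 + majorant_d1 \<gamma> t"
    using majorant_d1_mono[of \<gamma> n t] assms \<gamma>_pos by (simp add: n_def)
  finally show ?thesis .
qed

text \<open>Below \<open>ts\<close> the majorant has negative derivative, so \<open>G' x\<close> is
  closer than 1 to the identity, with \<open>q = 1 + majorant_d1 \<gamma> t\<close>.\<close>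

lemma G'_invertible:
  assumes "norm (x - x0) \<le> t" "t < ts"
  shows "blinfun_invertible (G' x)"
    and "norm (blinfun_inv (G' x) v) \<le> norm v / - majorant_d1 \<gamma> t"
proof -
  have "norm (id_blinfun - G' x) \<le> 1 + majorant_d1 \<gamma> t"
    using assms \<gamma>_times_less_1[of t] by (intro norm_id_minus_G') auto
  moreover have "1 + majorant_d1 \<gamma> t < 1" using majorant_d1_neg[of t] assms by simp
  ultimately show "blinfun_invertible (G' x)"
    "norm (blinfun_inv (G' x) v) \<le> norm v / - majorant_d1 \<gamma> t"
    using norm_blinfun_inv_near_id[of "G' x" "1 + majorant_d1 \<gamma> t"]
    by (auto intro: blinfun_near_id_invertible)
qed

text \<open>The factor \<open>(norm e / \<epsilon>) ^ 3\<close>, obtained from the convexity of the majorant's second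
  derivative, is what turns the scalar error recursion into the cubic estimate.\<close>

lemma taylor_remainder:
  assumes x: "norm (x - x0) \<le> \<tau>" and \<epsilon>: "0 < \<epsilon>" and e: "norm e \<le> \<epsilon>" and \<tau>\<epsilon>: "\<gamma> * (\<tau> + \<epsilon>) < 1"
  shows "norm (G (x + e) - G x - G' x e - (1 / 2) *\<^sub>R G'' x e e) \<le> (norm e / \<epsilon>) ^ 3 * remainder \<tau> \<epsilon>"
proof -
  define l where "l = norm e / \<epsilon>"
  define p where "p = norm (x - x0)"
  have l: "0 \<le> l" "l \<le> 1" "l * \<epsilon> = norm e" using \<epsilon> e by (auto simp: l_def)
  have line: "norm (x + s *\<^sub>R e - x0) < 1 / \<gamma>" "p + s * norm e < 1 / \<gamma>" "\<gamma> * (\<tau> + s * \<epsilon>) < 1"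
    if "0 \<le> s" "s \<le> 1" for s
  proof -
    have 1: "norm (x + s *\<^sub>R e - x0) \<le> p + s * norm e"
      using norm_triangle_ineq[of "x - x0" "s *\<^sub>R e"] that by (simp add: p_def algebra_simps)
    have 2: "p + s * norm e \<le> \<tau> + s * \<epsilon>" "s * \<epsilon> \<le> \<epsilon>"
      using that x e \<epsilon> by (auto simp: p_def intro!: add_mono mult_left_mono mult_left_le_one_le)
    then have "\<gamma> * (\<tau> + s * \<epsilon>) \<le> \<gamma> * (\<tau> + \<epsilon>)" using \<gamma>_pos by simp
    then show "\<gamma> * (\<tau> + s * \<epsilon>) < 1" using \<tau>\<epsilon> by linarith
    then have "\<tau> + s * \<epsilon> < 1 / \<gamma>" using less_inverse_iff by simp
    then show "p + s * norm e < 1 / \<gamma>" "norm (x + s *\<^sub>R e - x0) < 1 / \<gamma>" using 1 2 by linarith+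
  qed
  \<comment> \<open>The estimate is proved for second derivatives and integrated twice along the
    segment: \<open>k2\<close> bounds \<open>h2\<close>, then \<open>k1\<close> bounds
    \<open>h1\<close>, then \<open>k\<close> bounds \<open>h\<close>. One power in
    \<open>l ^ 3\<close> comes from the increment of the second derivative, two from
    \<open>norm e = l * \<epsilon>\<close>.\<close>
  define h where "h s = G (x + s *\<^sub>R e) - G x - s *\<^sub>R G' x e - (s\<^sup>2 / 2) *\<^sub>R G'' x e e" for s
  define h1 where "h1 s = G' (x + s *\<^sub>R e) e - G' x e - s *\<^sub>R G'' x e e" for s
  define h2 where "h2 s = G'' (x + s *\<^sub>R e) e e - G'' x e e" for s
  define k where "k s = l ^ 3 * (majorant \<beta> \<gamma> (\<tau> + s * \<epsilon>) - majorant \<beta> \<gamma> \<tau>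
    - s * (majorant_d1 \<gamma> \<tau> * \<epsilon>) - s\<^sup>2 / 2 * (majorant_d2 \<gamma> \<tau> * \<epsilon>\<^sup>2))" for s
  define k1 where "k1 s = l ^ 3 * (majorant_d1 \<gamma> (\<tau> + s * \<epsilon>) * \<epsilon> - majorant_d1 \<gamma> \<tau> * \<epsilon>
    - s * (majorant_d2 \<gamma> \<tau> * \<epsilon>\<^sup>2))" for s
  define k2 where "k2 s = l ^ 3 * (majorant_d2 \<gamma> (\<tau> + s * \<epsilon>) * \<epsilon>\<^sup>2 - majorant_d2 \<gamma> \<tau> * \<epsilon>\<^sup>2)" for s
  have dh: "(h has_vector_derivative h1 s) (at s)" and dh1: "(h1 has_vector_derivative h2 s) (at s)"
    and dk: "(k has_vector_derivative k1 s) (at s)" and dk1: "(k1 has_vector_derivative k2 s) (at s)"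
    if s: "0 \<le> s" "s \<le> 1" for s
  proof -
    note 0 = has_vector_derivative_along_line[OF has_derivative_G[OF line(1)[OF s]]]
      bounded_linear.has_vector_derivative[OF blinfun.bounded_linear_left
        has_vector_derivative_along_line[OF has_derivative_G'[OF line(1)[OF s]]], of e]
    show "(h has_vector_derivative h1 s) (at s)"
      unfolding h_def[abs_def] h1_def
      by (rule derivative_eq_intros 0 refl | simp)+
    show "(h1 has_vector_derivative h2 s) (at s)"
      unfolding h1_def[abs_def] h2_def
      by (rule derivative_eq_intros 0 refl | simp)+
    have lin: "((\<lambda>s. \<tau> + s * \<epsilon>) has_real_derivative \<epsilon>) (at s)"
      by (auto intro!: derivative_eq_intros)
    note 1 = DERIV_chain'[OF lin has_derivative_majorant[OF line(3)[OF s]]]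
      DERIV_chain'[OF lin has_derivative_majorant_d1[OF line(3)[OF s]]]
    show "(k has_vector_derivative k1 s) (at s)"
      unfolding k_def[abs_def] k1_def has_real_derivative_iff_has_vector_derivative[symmetric]
      by (rule derivative_eq_intros 1 refl | simp)+
    show "(k1 has_vector_derivative k2 s) (at s)"
      unfolding k1_def[abs_def] k2_def has_real_derivative_iff_has_vector_derivative[symmetric]
      by (rule derivative_eq_intros 1 refl | simp add: power2_eq_square)+
  qed
  have cont: "continuous_on {0..b} h" "continuous_on {0..b} h1" "continuous_on {0..b} k"
    "continuous_on {0..b} k1" if "b \<le> 1" for b
    using that
    by (auto intro!: continuous_at_imp_continuous_on
        intro: has_vector_derivative_continuous[OF dh] has_vector_derivative_continuous[OF dh1]
          has_vector_derivative_continuous[OF dk] has_vector_derivative_continuous[OF dk1])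
  have "norm (h2 s) \<le> k2 s" if s: "0 \<le> s" "s \<le> 1" for s
  proof -
    have "norm (h2 s) = norm ((G'' (x + s *\<^sub>R e) - G'' x) e e)"
      by (simp add: h2_def blinfun.diff_left)
    also have "\<dots> \<le> norm (G'' (x + s *\<^sub>R e) - G'' x) * norm e * norm e"
      by (rule norm_blinfun2)
    also have "\<dots> \<le> (majorant_d2 \<gamma> (p + s * norm e) - majorant_d2 \<gamma> p) * norm e * norm e"
      using G''_diff[of "x + s *\<^sub>R e" x] line(2)[OF s] s
      by (intro mult_right_mono) (auto simp: p_def add.commute)
    \<comment> \<open>The increment lemma is applied with step length \<open>s * \<epsilon>\<close>,
      whose \<open>l\<close>-fold is \<open>s * norm e\<close>.\<close>
    also have "\<dots> \<le> (l * (majorant_d2 \<gamma> (\<tau> + s * \<epsilon>) - majorant_d2 \<gamma> \<tau>)) * norm e * norm e"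
      using majorant_d2_increment_le[OF \<gamma>_pos, of p \<tau> "s * \<epsilon>" l] x s \<epsilon> l line(3)[OF s]
      by (intro mult_right_mono) (auto simp: p_def mult.left_commute[of l])
    also have "\<dots> = k2 s"
      by (simp add: k2_def l(3)[symmetric] algebra_simps power2_eq_square power3_eq_cube)
    finally show ?thesis .
  qed
  note h2 = this
  have h1: "norm (h1 s) \<le> k1 s" if s: "0 < s" "s < 1" for s
  proof -
    have "norm (h1 s - h1 0) \<le> k1 s - k1 0"
      using s by (intro differentiable_bound_general[where f' = h2 and \<phi>' = k2] cont dh1 dk1 h2) auto
    then show ?thesis by (simp add: h1_def k1_def)
  qed
  have "norm (h 1 - h 0) \<le> k 1 - k 0"
    by (intro differentiable_bound_general[where f' = h1 and \<phi>' = k1] cont dh dk h1) auto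
  then show ?thesis by (simp add: h_def k_def l_def remainder_def)
qed

section \<open>One operator step from a point \<open>x\<close> that is majorized by
  \<open>t\<close>\<close>

definition "halley_step x = x - blinfun_inv (id_blinfun - halley_L G G' G'' x) (blinfun_inv (G' x) (G x))"

context
  fixes x :: 'a and t :: real
  assumes x: "norm (x - x0) \<le> t" and t: "t < ts" and Gx: "norm (G x) \<le> majorant \<beta> \<gamma> t"
begin

private abbreviation "\<Gamma> \<equiv> blinfun_inv (G' x)"
private abbreviation "L \<equiv> halley_L G G' G'' x"
private abbreviation "Lt \<equiv> scalar_halley_L (majorant \<beta> \<gamma>) t"

lemma t_nonneg: "0 \<le> t"
  using x norm_ge_zero[of "x - x0"] by linarith

lemma \<gamma>_t: "\<gamma> * t < 1"
  using \<gamma>_times_less_1[of t] t by simp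

lemma neg_majorant_d1_pos: "0 < - majorant_d1 \<gamma> t"
  using majorant_d1_neg[of t] t by simp

lemma halley_L_apply: "L v = (1 / 2) *\<^sub>R \<Gamma> (G'' x (\<Gamma> (G x)) v)"
  by (simp add: halley_L_def blinfun.scaleR_left)

lemma norm_\<Gamma>_G'': "norm (\<Gamma> (G'' x u v)) \<le> majorant_d2 \<gamma> t / - majorant_d1 \<gamma> t * norm u * norm v"
proof -
  have "norm (\<Gamma> (G'' x u v)) \<le> norm (G'' x u v) / - majorant_d1 \<gamma> t"
    by (rule G'_invertible[OF x t])
  also have "\<dots> \<le> (majorant_d2 \<gamma> t * norm u * norm v) / - majorant_d1 \<gamma> t"
    using norm_blinfun2[of "G'' x" u v] norm_G''[OF x \<gamma>_t] neg_majorant_d1_pos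
    by (intro divide_right_mono) (auto elim!: order.trans intro!: mult_right_mono)
  finally show ?thesis by simp
qed

lemma norm_newton: "norm (\<Gamma> (G x)) \<le> majorant \<beta> \<gamma> t / - majorant_d1 \<gamma> t"
  using G'_invertible(2)[OF x t, of "G x"] divide_right_mono[OF Gx, of "- majorant_d1 \<gamma> t"] neg_majorant_d1_pos
  by linarith

text \<open>The bounds for the Newton correction and for \<open>\<Gamma>\<close> after
  \<open>G''\<close> multiply to exactly the scalar quantity \<open>Lt\<close>.\<close>

lemma norm_halley_L: "norm L \<le> Lt"
proof (rule norm_blinfun_bound)
  show "0 \<le> Lt" using scalar_step(1)[OF t_nonneg t] .
  fix v
  have "norm (L v) \<le> 1 / 2 * (majorant_d2 \<gamma> t / - majorant_d1 \<gamma> t * norm (\<Gamma> (G x)) * norm v)"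
    unfolding halley_L_apply using norm_\<Gamma>_G''[of "\<Gamma> (G x)" v] by simp
  also have "\<dots> \<le> 1 / 2 * (majorant_d2 \<gamma> t / - majorant_d1 \<gamma> t *
      (majorant \<beta> \<gamma> t / - majorant_d1 \<gamma> t) * norm v)"
    using norm_newton neg_majorant_d1_pos majorant_d2_pos[OF \<gamma>_t]
    by (intro mult_left_mono mult_right_mono) (auto simp: divide_nonneg_neg)
  also have "\<dots> = Lt * norm v"
    unfolding scalar_halley_L_majorant[OF \<gamma>_t] using neg_majorant_d1_pos by (simp add: field_simps power2_eq_square)
  finally show "norm (L v) \<le> Lt * norm v" .
qed

lemma id_minus_halley_L:
  shows id_minus_halley_L_invertible: "blinfun_invertible (id_blinfun - L)"
    and norm_inv_id_minus_halley_L: "norm (blinfun_inv (id_blinfun - L) v) \<le> norm v / (1 - Lt)"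
proof -
  have 1: "norm (id_blinfun - (id_blinfun - L)) \<le> Lt" using norm_halley_L by simp
  note 2 = scalar_step(2)[OF t_nonneg t]
  show "blinfun_invertible (id_blinfun - L)"
    using 1 2 by (intro blinfun_near_id_invertible) linarith
  show "norm (blinfun_inv (id_blinfun - L) v) \<le> norm v / (1 - Lt)"
    by (rule norm_blinfun_inv_near_id[OF 1 2])
qed

lemma halley_step_equation: "halley_step x - x - L (halley_step x - x) = - \<Gamma> (G x)"
proof -
  have "(id_blinfun - L) (blinfun_inv (id_blinfun - L) (\<Gamma> (G x))) = \<Gamma> (G x)"
    by (rule blinfun_inv_apply(2)[OF id_minus_halley_L_invertible])
  then show ?thesis
    by (simp add: halley_step_def blinfun.diff_left blinfun.minus_right algebra_simps)
qed

lemma norm_halley_step: "norm (halley_step x - x) \<le> step t - t"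
proof -
  have "norm (halley_step x - x) \<le> norm (\<Gamma> (G x)) / (1 - Lt)"
    using norm_inv_id_minus_halley_L by (simp add: halley_step_def)
  also have "\<dots> \<le> (majorant \<beta> \<gamma> t / - majorant_d1 \<gamma> t) / (1 - Lt)"
    using norm_newton scalar_step(2)[OF t_nonneg t] by (intro divide_right_mono) auto
  also have "majorant \<beta> \<gamma> t / - majorant_d1 \<gamma> t = (1 - Lt) * (step t - t)"
    using step_minus[OF t_nonneg t] by simp
  also have "\<dots> / (1 - Lt) = step t - t"
    using scalar_step(2)[OF t_nonneg t] by simp
  finally show ?thesis .
qed

lemma halley_step_in_ball: "norm (halley_step x - x0) \<le> step t"
  using norm_triangle_ineq[of "halley_step x - x" "x - x0"] norm_halley_step x by simp

lemma G'_\<Gamma>: "G' x (\<Gamma> v) = v" and \<Gamma>_G': "\<Gamma> (G' x v) = v"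
  using blinfun_inv_apply[OF G'_invertible(1)[OF x t]] by auto

text \<open>Operator version of \<open>majorant_step\<close>: the same cancellation leaves
  \<open>G''\<close> at \<open>(L r, r)\<close> and a remainder, and each is bounded by its scalar
  counterpart.\<close>

lemma norm_G_halley_step: "norm (G (halley_step x)) \<le> majorant \<beta> \<gamma> (step t)"
proof -
  define r where "r = halley_step x - x"
  define u where "u = \<Gamma> (G x)"
  define R where "R = G (x + r) - G x - G' x r - (1 / 2) *\<^sub>R G'' x r r"
  have eq: "r - L r = - u" using halley_step_equation by (simp add: r_def u_def)
  have r: "norm r \<le> step t - t" using norm_halley_step by (simp add: r_def)
  have bounds: "t < step t" "\<gamma> * step t < 1"
    using step_bounds[OF t_nonneg t] \<gamma>_times_less_1[of "step t"] by auto
  \<comment> \<open>Applying \<open>G' x\<close> to this form of Halley's equation, and to the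
    definition of \<open>L\<close>, gives two expressions for the same vector; comparing them
    evaluates the linear Taylor part.\<close>
  have "L r = r + u" using eq by (simp add: algebra_simps)
  then have "G' x (L r) = G' x r + G x" by (simp add: blinfun.add_right u_def G'_\<Gamma>)
  moreover have "G' x (L r) = (1 / 2) *\<^sub>R G'' x u r"
    by (simp add: halley_L_apply blinfun.scaleR_right G'_\<Gamma> u_def)
  ultimately have "G x + G' x r = (1 / 2) *\<^sub>R G'' x u r" by (simp add: add.commute)
  moreover have "G (x + r) = (G x + G' x r) + (1 / 2) *\<^sub>R G'' x r r + R" by (simp add: R_def)
  ultimately have "G (x + r) = (1 / 2) *\<^sub>R (G'' x u r + G'' x r r) + R"
    by (simp add: scaleR_add_right)
  also have "G'' x u r + G'' x r r = G'' x (L r) r"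
    unfolding \<open>L r = r + u\<close> by (simp add: blinfun.add_right blinfun.add_left add.commute)
  finally have "G (halley_step x) = (1 / 2) *\<^sub>R G'' x (L r) r + R" by (simp add: r_def)
  then have "norm (G (halley_step x)) \<le> norm (G'' x (L r) r) / 2 + norm R"
    using norm_triangle_ineq[of "(1 / 2) *\<^sub>R G'' x (L r) r" R] by simp
  also have "\<dots> \<le> majorant_d2 \<gamma> t * (Lt * (step t - t)) * (step t - t) / 2 + remainder t (step t - t)"
  proof (rule add_mono)
    have "norm (G'' x (L r) r) \<le> norm (G'' x) * norm (L r) * norm r" by (rule norm_blinfun2)
    also have "\<dots> \<le> majorant_d2 \<gamma> t * (Lt * (step t - t)) * (step t - t)"
    proof (intro mult_mono)
      show "norm (L r) \<le> Lt * (step t - t)"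
        using order.trans[OF norm_blinfun mult_mono[OF norm_halley_L r]] scalar_step(1)[OF t_nonneg t]
        by simp
    qed (use r norm_G''[OF x \<gamma>_t] majorant_d2_pos[OF \<gamma>_t] scalar_step(1)[OF t_nonneg t] bounds
      in \<open>auto intro!: mult_nonneg_nonneg\<close>)
    finally show "norm (G'' x (L r) r) / 2 \<le> majorant_d2 \<gamma> t * (Lt * (step t - t)) * (step t - t) / 2"
      by simp
    have "norm R \<le> (norm r / (step t - t)) ^ 3 * remainder t (step t - t)"
      unfolding R_def using r bounds by (intro taylor_remainder x) auto
    also have "\<dots> \<le> 1 * remainder t (step t - t)"
    proof (rule mult_right_mono)
      show "(norm r / (step t - t)) ^ 3 \<le> 1"
        using r bounds by (intro power_le_one) auto
      show "0 \<le> remainder t (step t - t)"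
        using remainder_nonneg[of "step t - t" t] bounds by simp
    qed
    finally show "norm R \<le> remainder t (step t - t)" by simp
  qed
  also have "\<dots> = majorant \<beta> \<gamma> (step t)" by (rule majorant_step[OF t_nonneg t, symmetric])
  finally show ?thesis .
qed

text \<open>Operator version of \<open>error_identity\<close>. Every term of \<open>d - L d\<close>
  is at least cubic in \<open>e\<close>, so relative to the scalar bound a factor
  \<open>l ^ 3\<close> survives.\<close>

lemma halley_step_error:
  assumes z: "G z = 0" "norm (z - x) \<le> ts - t"
  shows "norm (z - halley_step x) \<le> (ts - step t) * (norm (z - x) / (ts - t)) ^ 3"
proof -
  define e where "e = z - x"
  define \<epsilon> where "\<epsilon> = ts - t"
  define l where "l = norm e / \<epsilon>"
  define c where "c = majorant_d2 \<gamma> t / - majorant_d1 \<gamma> t"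
  define Rt where "Rt = remainder t \<epsilon> / - majorant_d1 \<gamma> t"
  define u where "u = \<Gamma> (G x)"
  define R where "R = \<Gamma> (G (x + e) - G x - G' x e - (1 / 2) *\<^sub>R G'' x e e)"
  define d where "d = z - halley_step x"
  have \<epsilon>: "0 < \<epsilon>" "\<gamma> * (t + \<epsilon>) < 1" using t \<gamma>_times_less_1[of ts] by (simp_all add: \<epsilon>_def)
  have l: "0 \<le> l" "l \<le> 1" "norm e = l * \<epsilon>" using z \<epsilon> by (auto simp: l_def e_def \<epsilon>_def)
  have c: "0 \<le> c" using majorant_d2_pos[OF \<gamma>_t] neg_majorant_d1_pos by (simp add: c_def divide_nonneg_neg)
  note cG = norm_\<Gamma>_G''[folded c_def]
  have R: "norm R \<le> l ^ 3 * Rt"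
  proof -
    have "norm R \<le> (norm e / \<epsilon>) ^ 3 * remainder t \<epsilon> / - majorant_d1 \<gamma> t"
      unfolding R_def
      using order.trans[OF G'_invertible(2)[OF x t] divide_right_mono[OF taylor_remainder[OF x \<epsilon>(1) _ \<epsilon>(2), of e]]]
        l neg_majorant_d1_pos \<epsilon> by (simp add: mult_left_le_one_le)
    then show ?thesis by (simp add: Rt_def l_def)
  qed
  \<comment> \<open>Taylor expansion of \<open>G z = 0\<close> at \<open>x\<close>, after applying
    \<open>\<Gamma>\<close>: \<open>u + e\<close> is at least quadratic in \<open>e\<close>.\<close>
  have ue: "u + e = - ((1 / 2) *\<^sub>R \<Gamma> (G'' x e e) + R)"
  proof -
    have "R = - (u + e + (1 / 2) *\<^sub>R \<Gamma> (G'' x e e))"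
      using z by (simp add: R_def u_def e_def blinfun.diff_right blinfun.minus_right blinfun.scaleR_right \<Gamma>_G'
          del: scaleR_half_double)
    then show ?thesis by simp
  qed
  have "d - L d = e - L e + u"
  proof -
    define r where "r = halley_step x - x"
    have "d = e - r" by (simp add: d_def e_def r_def)
    then have "d - L d = e - L e - (r - L r)" by (simp add: blinfun.diff_right)
    also have "r - L r = - u" using halley_step_equation by (simp only: r_def u_def)
    finally show ?thesis by simp
  qed
  also have "\<dots> = - ((1 / 2) *\<^sub>R \<Gamma> (G'' x (u + e) e) + R)"
  proof -
    have "L e = (1 / 2) *\<^sub>R \<Gamma> (G'' x u e)" by (simp add: halley_L_apply u_def)
    moreover have "(1 / 2) *\<^sub>R \<Gamma> (G'' x (u + e) e) = (1 / 2) *\<^sub>R \<Gamma> (G'' x u e) + (1 / 2) *\<^sub>R \<Gamma> (G'' x e e)"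
      by (simp add: blinfun.add_right blinfun.add_left scaleR_add_right)
    ultimately show ?thesis using ue by (simp add: algebra_simps)
  qed
  finally have "norm (d - L d) \<le> norm (\<Gamma> (G'' x (u + e) e)) / 2 + norm R"
    using norm_triangle_ineq[of "(1 / 2) *\<^sub>R \<Gamma> (G'' x (u + e) e)" R] by (simp only: norm_minus_cancel) simp
  also have "\<dots> \<le> (c * ((c * \<epsilon>\<^sup>2 / 2 + Rt) * l\<^sup>2) * (l * \<epsilon>)) / 2 + l ^ 3 * Rt"
  proof (rule add_mono[OF divide_right_mono R])
    have "norm (u + e) \<le> norm (\<Gamma> (G'' x e e)) / 2 + norm R"
      unfolding ue using norm_triangle_ineq[of "(1 / 2) *\<^sub>R \<Gamma> (G'' x e e)" R]
      by (simp only: norm_minus_cancel) simp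
    also have "\<dots> \<le> (c * norm e * norm e) / 2 + l ^ 3 * Rt"
      by (intro add_mono divide_right_mono cG R) auto
    \<comment> \<open>One power of \<open>l\<close> is given away so that both terms share the
      factor \<open>l\<^sup>2\<close>; the factor \<open>norm e\<close> outside restores the third
      power.\<close>
    also have "\<dots> \<le> (c * norm e * norm e) / 2 + l ^ 2 * Rt"
    proof -
      have "0 \<le> Rt" using remainder_nonneg[of \<epsilon> t] \<epsilon> neg_majorant_d1_pos
        by (simp add: Rt_def divide_nonneg_neg)
      moreover have "l ^ 3 \<le> l ^ 2" using l by (intro power_decreasing) auto
      ultimately show ?thesis by (intro add_left_mono mult_right_mono)
    qed
    also have "\<dots> = (c * \<epsilon>\<^sup>2 / 2 + Rt) * l\<^sup>2" unfolding l(3) by (simp add: algebra_simps power2_eq_square)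
    finally have "norm (u + e) \<le> (c * \<epsilon>\<^sup>2 / 2 + Rt) * l\<^sup>2" .
    then have "c * norm (u + e) * norm e \<le> c * ((c * \<epsilon>\<^sup>2 / 2 + Rt) * l\<^sup>2) * norm e"
      using c by (intro mult_right_mono mult_left_mono) auto
    then show "norm (\<Gamma> (G'' x (u + e) e)) \<le> c * ((c * \<epsilon>\<^sup>2 / 2 + Rt) * l\<^sup>2) * (l * \<epsilon>)"
      using cG[of "u + e" e] unfolding l(3)[symmetric] by linarith
  qed simp
  also have "\<dots> = (c * (c * \<epsilon>\<^sup>2 / 2 + Rt) * \<epsilon> / 2 + Rt) * l ^ 3"
    by (simp add: algebra_simps power2_eq_square power3_eq_cube)
  also have "\<dots> = (1 - Lt) * ((ts - step t) * l ^ 3)"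
    unfolding c_def Rt_def \<epsilon>_def error_identity[OF t_nonneg t, symmetric] by simp
  finally have "norm (d - L d) \<le> (1 - Lt) * ((ts - step t) * l ^ 3)" .
  moreover have "(1 - Lt) * norm d \<le> norm (d - L d)"
  proof -
    have "norm (L d) \<le> Lt * norm d"
      using order.trans[OF norm_blinfun mult_right_mono[OF norm_halley_L]] by simp
    then show ?thesis using norm_triangle_ineq2[of d "L d"] by (simp add: algebra_simps)
  qed
  ultimately have "(1 - Lt) * norm d \<le> (1 - Lt) * ((ts - step t) * l ^ 3)" by simp
  then show ?thesis
    using scalar_step(2)[OF t_nonneg t] by (simp add: d_def l_def e_def \<epsilon>_def)
qed

end

end

section \<open>Convergence of the operator sequence and uniqueness of the zero\<close>

context halley_operator
begin

definition "xk k = halley_seq G G' G'' x0 k"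

lemma xk_0: "xk 0 = x0" and xk_Suc: "xk (Suc k) = halley_step (xk k)"
  by (simp_all add: xk_def halley_step_def Let_def)

lemma xk_bounds: "norm (xk k - x0) \<le> tk k" "norm (G (xk k)) \<le> majorant \<beta> \<gamma> (tk k)"
proof -
  have "norm (xk k - x0) \<le> tk k \<and> norm (G (xk k)) \<le> majorant \<beta> \<gamma> (tk k)"
  proof (induction k)
    case 0
    \<comment> \<open>The induction starts because the majorant takes the value
      \<open>\<beta>\<close> at 0.\<close>
    then show ?case using G_x0 by (simp add: xk_0 tk_0 majorant_def)
  next
    case (Suc k)
    then show ?case
      using halley_step_in_ball[of "xk k" "tk k"] norm_G_halley_step[of "xk k" "tk k"] tk_bounds(2)
      by (simp add: xk_Suc tk_Suc)
  qed
  then show "norm (xk k - x0) \<le> tk k" "norm (G (xk k)) \<le> majorant \<beta> \<gamma> (tk k)" by auto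
qed

lemma norm_xk_diff: "norm (xk (k + n) - xk k) \<le> tk (k + n) - tk k"
proof (induction n)
  case (Suc n)
  have "norm (xk (Suc (k + n)) - xk (k + n)) \<le> tk (Suc (k + n)) - tk (k + n)"
    unfolding xk_Suc tk_Suc by (rule norm_halley_step[OF xk_bounds(1) tk_bounds(2) xk_bounds(2)])
  then show ?case
    using Suc norm_triangle_ineq[of "xk (Suc (k + n)) - xk (k + n)" "xk (k + n) - xk k"] by simp
qed simp

text \<open>Increments of \<open>xk\<close> are dominated by those of the convergent sequence
  \<open>tk\<close>, so \<open>xk\<close> is Cauchy. The bounds pass to the limit, and
  \<open>G xs = 0\<close> because the majorant vanishes at \<open>ts\<close>.\<close>

lemma xk_convergent:
  obtains xs where "xk \<longlonglongrightarrow> xs" "\<And>k. norm (xs - xk k) \<le> ts - tk k" "norm (xs - x0) \<le> ts" "G xs = 0"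
proof -
  have "Cauchy xk"
  proof (rule CauchyI)
    fix e :: real assume "0 < e"
    then have "\<forall>\<^sub>F k in sequentially. ts - e / 2 < tk k"
      using order_tendstoD(1)[OF tk_tendsto] by simp
    then obtain N where N: "ts - e / 2 < tk N" by (auto simp: eventually_sequentially)
    have near: "norm (xk k - xk N) < e / 2" if "N \<le> k" for k
      using norm_xk_diff[of N "k - N"] tk_bounds(2)[of k] N that by simp
    have "norm (xk m - xk n) < e" if "N \<le> m" "N \<le> n" for m n
      by (rule norm_triangle_half_l[OF near near]) (rule that)+
    then show "\<exists>N. \<forall>m\<ge>N. \<forall>n\<ge>N. norm (xk m - xk n) < e" by blast
  qed
  then obtain xs where lim: "xk \<longlonglongrightarrow> xs" using Cauchy_convergent_iff convergent_def by blast
  have dist: "norm (xs - xk k) \<le> ts - tk k" for k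
  proof (rule Lim_bounded)
    show "(\<lambda>n. norm (xk n - xk k)) \<longlonglongrightarrow> norm (xs - xk k)" by (intro tendsto_intros lim)
    show "\<forall>n\<ge>k. norm (xk n - xk k) \<le> ts - tk k"
    proof (intro allI impI)
      fix n assume "k \<le> n"
      then show "norm (xk n - xk k) \<le> ts - tk k"
        using norm_xk_diff[of k "n - k"] tk_bounds(2)[of n] by simp
    qed
  qed
  then have ball: "norm (xs - x0) \<le> ts" using dist[of 0] by (simp add: xk_0 tk_0)
  have \<gamma>ts: "\<gamma> * ts < 1" by (rule \<gamma>_times_less_1) simp
  then have "ts < 1 / \<gamma>" using less_inverse_iff by simp
  then have "isCont G xs"
    using has_derivative_continuous[OF has_derivative_G] ball by simp
  then have "(\<lambda>k. norm (G (xk k))) \<longlonglongrightarrow> norm (G xs)"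
    by (intro tendsto_norm isCont_tendsto_compose[OF _ lim])
  moreover have "(\<lambda>k. majorant \<beta> \<gamma> (tk k)) \<longlonglongrightarrow> majorant \<beta> \<gamma> ts"
    by (rule isCont_tendsto_compose[OF DERIV_isCont[OF has_derivative_majorant[OF \<gamma>ts]] tk_tendsto])
  ultimately have "norm (G xs) \<le> majorant \<beta> \<gamma> ts"
    using xk_bounds(2) by (intro LIMSEQ_le) auto
  then have "G xs = 0" by (simp add: majorant_ts)
  then show ?thesis using lim dist ball that by blast
qed

text \<open>Between \<open>ts\<close> and \<open>tss\<close> the derivative of the majorant changes
  sign, so \<open>G'\<close> need not stay within distance 1 of the identity. Only its mean over the
  segment matters: the difference quotient of the majorant from \<open>ts\<close> to
  \<open>\<rho>\<close> is negative.\<close>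

lemma zero_unique:
  assumes y: "G y = 0" "norm (y - x0) \<le> ts" and z: "G z = 0" "norm (z - x0) < tss"
  shows "z = y"
proof -
  \<comment> \<open>The midpoint keeps \<open>\<rho>\<close> strictly above \<open>ts\<close> even
    when \<open>z\<close> is close to \<open>x0\<close>.\<close>
  define \<rho> where "\<rho> = max (norm (z - x0)) ((ts + tss) / 2)"
  have \<rho>: "ts < \<rho>" "\<rho> < tss" "norm (z - x0) \<le> \<rho>" using z ts_less by (auto simp: \<rho>_def less_max_iff_disj)
  define n where "n = norm (z - y)"
  define h where "h s = G (y + s *\<^sub>R (z - y)) - s *\<^sub>R (z - y)" for s
  define h' where "h' s = G' (y + s *\<^sub>R (z - y)) (z - y) - (z - y)" for s
  define q where "q s = ts + s * (\<rho> - ts)" for s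
  \<comment> \<open>\<open>k\<close> majorizes \<open>h\<close>, and \<open>k 1 - k 0 < n\<close> unless \<open>n = 0\<close> because the majorant vanishes at \<open>ts\<close>
    and is negative at \<open>\<rho>\<close>\<close>
  define k where "k s = n * (s + majorant \<beta> \<gamma> (q s) / (\<rho> - ts))" for s
  define k' where "k' s = n * (1 + majorant_d1 \<gamma> (q s))" for s
  have line: "norm (y + s *\<^sub>R (z - y) - x0) \<le> q s" "\<gamma> * q s < 1" if s: "0 \<le> s" "s \<le> 1" for s
  proof -
    have "y + s *\<^sub>R (z - y) - x0 = (1 - s) *\<^sub>R (y - x0) + s *\<^sub>R (z - x0)"
      by (simp add: algebra_simps)
    also have "norm \<dots> \<le> (1 - s) * norm (y - x0) + s * norm (z - x0)"
      using norm_triangle_ineq[of "(1 - s) *\<^sub>R (y - x0)" "s *\<^sub>R (z - x0)"] s by simp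
    also have "\<dots> \<le> (1 - s) * ts + s * \<rho>"
      using s y \<rho> by (intro add_mono mult_left_mono) auto
    finally show "norm (y + s *\<^sub>R (z - y) - x0) \<le> q s" by (simp add: q_def algebra_simps)
    have "s * (\<rho> - ts) \<le> \<rho> - ts" using s \<rho> by (intro mult_left_le_one_le) auto
    then have "q s < tss" unfolding q_def using \<rho> by linarith
    then show "\<gamma> * q s < 1" using mult_strict_left_mono[of "q s" tss \<gamma>] \<gamma>_pos \<gamma>_tss by linarith
  qed
  have dh: "(h has_vector_derivative h' s) (at s)" and dk: "(k has_vector_derivative k' s) (at s)"
    if s: "0 \<le> s" "s \<le> 1" for s
  proof -
    have "norm (y + s *\<^sub>R (z - y) - x0) < 1 / \<gamma>"
      using line[OF s] less_inverse_iff[of "q s"] by linarith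
    note 0 = has_vector_derivative_along_line[OF has_derivative_G[OF this]]
    show "(h has_vector_derivative h' s) (at s)"
      unfolding h_def[abs_def] h'_def by (rule derivative_eq_intros 0 refl | simp)+
    have "(q has_real_derivative (\<rho> - ts)) (at s)"
      unfolding q_def[abs_def] by (auto intro!: derivative_eq_intros)
    note 1 = DERIV_chain'[OF this has_derivative_majorant[OF line(2)[OF s]]]
    show "(k has_vector_derivative k' s) (at s)"
      unfolding k_def[abs_def] k'_def has_real_derivative_iff_has_vector_derivative[symmetric]
      using \<rho> by (auto intro!: derivative_eq_intros 1)
  qed
  have "norm (h 1 - h 0) \<le> k 1 - k 0"
  proof (rule differentiable_bound_general[where f' = h' and \<phi>' = k'])
    show "continuous_on {0..1} h" "continuous_on {0..1} k"
      by (auto intro!: continuous_at_imp_continuous_on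
          intro: has_vector_derivative_continuous[OF dh] has_vector_derivative_continuous[OF dk])
    fix s :: real assume "0 < s" "s < 1"
    then have s: "0 \<le> s" "s \<le> 1" by auto
    have "h' s = - (id_blinfun - G' (y + s *\<^sub>R (z - y))) (z - y)"
      by (simp add: h'_def blinfun.diff_left)
    then have "norm (h' s) \<le> norm (id_blinfun - G' (y + s *\<^sub>R (z - y))) * n"
      unfolding n_def using norm_blinfun by (simp only: norm_minus_cancel)
    also have "\<dots> \<le> (1 + majorant_d1 \<gamma> (q s)) * n"
      using norm_id_minus_G'[OF line[OF s]] by (intro mult_right_mono) (auto simp: n_def)
    finally show "norm (h' s) \<le> k' s" by (simp add: k'_def mult.commute)
  qed (use dh dk in auto)
  \<comment> \<open>Since \<open>G\<close> vanishes at both ends, \<open>h 1 - h 0\<close> is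
    \<open>- (z - y)\<close>, of norm \<open>n\<close>.\<close>
  then have "n \<le> n * (1 + majorant \<beta> \<gamma> \<rho> / (\<rho> - ts))"
    using y z by (simp add: h_def k_def q_def n_def majorant_ts norm_minus_commute)
  then have "0 \<le> n * (majorant \<beta> \<gamma> \<rho> / (\<rho> - ts))" by (simp add: distrib_left)
  moreover have "majorant \<beta> \<gamma> \<rho> / (\<rho> - ts) < 0"
    using majorant_neg[OF \<rho>(1,2)] \<rho> by (simp add: divide_neg_pos)
  ultimately have "n \<le> 0" by (meson mult_pos_neg not_le)
  then show ?thesis by (simp add: n_def)
qed

lemma xk_invertible:
  "blinfun_invertible (G' (xk k))" "blinfun_invertible (id_blinfun - halley_L G G' G'' (xk k))"
  using G'_invertible(1)[OF xk_bounds(1) tk_bounds(2)]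
    id_minus_halley_L_invertible[OF xk_bounds(1) tk_bounds(2) xk_bounds(2)] by auto

lemma xk_error:
  assumes "G z = 0" "norm (z - xk k) \<le> ts - tk k"
  shows "norm (z - xk (Suc k)) \<le> (ts - tk (Suc k)) * (norm (z - xk k) / (ts - tk k)) ^ 3"
  unfolding xk_Suc tk_Suc using halley_step_error[OF xk_bounds(1) tk_bounds(2) xk_bounds(2) assms] .

text \<open>The scalar cubic estimate supplies the third power of \<open>ts - tk k\<close> that
  cancels the denominator in \<open>xk_error\<close>.\<close>

lemma xk_cubic:
  assumes "G z = 0" "norm (z - xk k) \<le> ts - tk k"
  shows "norm (z - xk (Suc k)) \<le> 2 * \<gamma>\<^sup>2 / (2 * wa\<^sup>2 - 1)\<^sup>2 * norm (z - xk k) ^ 3"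
proof -
  have pos: "0 < ts - tk k" using tk_bounds(2) by simp
  have "norm (z - xk (Suc k)) \<le> (ts - tk (Suc k)) * (norm (z - xk k) / (ts - tk k)) ^ 3"
    by (rule xk_error[OF assms])
  also have "\<dots> \<le> (2 * \<gamma>\<^sup>2 / (2 * wa\<^sup>2 - 1)\<^sup>2 * (ts - tk k) ^ 3) * (norm (z - xk k) / (ts - tk k)) ^ 3"
    unfolding tk_Suc using pos by (intro mult_right_mono step_cubic tk_bounds) auto
  also have "\<dots> = 2 * \<gamma>\<^sup>2 / (2 * wa\<^sup>2 - 1)\<^sup>2 * norm (z - xk k) ^ 3"
    using pos by (simp add: power_divide)
  finally show ?thesis .
qed

end

section \<open>Invariance of Halley's method under composition with a fixed inverse operator\<close>

lemma blinfun_inv_precomposed: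
  assumes "blinfun_invertible A" "blinfun_invertible (blinfun_inv A o\<^sub>L M)"
  shows "blinfun_invertible M"
    and "blinfun_inv M = blinfun_inv (blinfun_inv A o\<^sub>L M) o\<^sub>L blinfun_inv A"
proof -
  let ?N = "blinfun_inv A o\<^sub>L M"
  have A: "blinfun_inv A (A v) = v" "A (blinfun_inv A w) = w" for v w
    using blinfun_inv_apply[OF assms(1)] by auto
  have N: "blinfun_inv ?N (blinfun_inv A (M v)) = v" "blinfun_inv A (M (blinfun_inv ?N w)) = w" for v w
    using blinfun_inv_apply[OF assms(2)] by auto
  have 1: "(blinfun_inv ?N o\<^sub>L blinfun_inv A) o\<^sub>L M = id_blinfun"
    by (rule blinfun_eqI) (simp add: N)
  have "M (blinfun_inv ?N (blinfun_inv A w)) = w" for w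
    using N(2)[of "blinfun_inv A w"] A(2) by metis
  then have 2: "M o\<^sub>L (blinfun_inv ?N o\<^sub>L blinfun_inv A) = id_blinfun"
    by (intro blinfun_eqI) simp
  show "blinfun_invertible M" unfolding blinfun_invertible_def using 1 2 by blast
  show "blinfun_inv M = blinfun_inv ?N o\<^sub>L blinfun_inv A" by (rule blinfun_inv_eqI[OF 1 2])
qed

context
  fixes F :: "'a::real_normed_vector \<Rightarrow> 'b::real_normed_vector" and F' :: "'a \<Rightarrow> 'a \<Rightarrow>\<^sub>L 'b"
    and F'' :: "'a \<Rightarrow> 'a \<Rightarrow>\<^sub>L 'a \<Rightarrow>\<^sub>L 'b" and A :: "'a \<Rightarrow>\<^sub>L 'b" and G G' G''
  assumes A: "blinfun_invertible A"
  defines "G \<equiv> \<lambda>z. blinfun_inv A (F z)" and "G' \<equiv> \<lambda>z. blinfun_inv A o\<^sub>L F' z"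
    and "G'' \<equiv> \<lambda>z. bilinear_postcomp (blinfun_inv A) (F'' z)"
begin

text \<open>The inverse of \<open>G' x\<close> is that of \<open>F' x\<close> followed after
  \<open>A\<close>, so \<open>A\<close> cancels against its inverse in \<open>G\<close> and
  \<open>G''\<close>.\<close>

lemma halley_L_precomposed:
  assumes "blinfun_invertible (G' x)"
  shows "halley_L G G' G'' x = halley_L F F' F'' x"
    and "blinfun_inv (G' x) (G x) = blinfun_inv (F' x) (F x)"
  using blinfun_inv_precomposed(2)[OF A assms[unfolded G'_def]]
  by (auto intro!: blinfun_eqI simp: halley_L_def G_def G'_def G''_def blinfun.scaleR_left)

lemma halley_seq_precomposed:
  assumes "\<And>k. blinfun_invertible (G' (halley_seq G G' G'' x0 k))"
  shows "halley_seq F F' F'' x0 k = halley_seq G G' G'' x0 k"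
  by (induction k) (simp_all add: Let_def halley_L_precomposed[OF assms])

end

text \<open>The conjunct about \<open>t k\<close> states that the scalar sequence is well defined
  too: division is total with value 0 at denominator 0, so that the denominators do not vanish has
  to be asserted separately.\<close>

theorem theorem6:
  fixes D :: "'a::banach set"
    and F :: "'a \<Rightarrow> 'b::banach"
    and F' :: "'a \<Rightarrow> 'a \<Rightarrow>\<^sub>L 'b"
    and F'' :: "'a \<Rightarrow> 'a \<Rightarrow>\<^sub>L 'a \<Rightarrow>\<^sub>L 'b"
    and x0 :: 'a
    and \<beta> \<gamma> \<alpha> tstar tstarstar :: real
    and x :: "nat \<Rightarrow> 'a"
    and t :: "nat \<Rightarrow> real"
  assumes "D \<noteq> {}" "open D" "convex D"
    and "\<And>z. z \<in> D \<Longrightarrow> (F has_derivative blinfun_apply (F' z)) (at z)"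
    and "\<And>z. z \<in> D \<Longrightarrow> (F' has_derivative blinfun_apply (F'' z)) (at z)"
    and "continuous_on D F''"
    and "x0 \<in> D"
    and "blinfun_invertible (F' x0)"
    and "\<beta> > 0" "\<gamma> > 0"
    and "ball x0 (1 / \<gamma>) \<subseteq> D"
    and "\<And>u v. u \<in> ball x0 (1 / \<gamma>) \<Longrightarrow> v \<in> ball x0 (1 / \<gamma>) \<Longrightarrow>
           norm (v - u) + norm (u - x0) < 1 / \<gamma> \<Longrightarrow>
           norm (bilinear_postcomp (blinfun_inv (F' x0)) (F'' v - F'' u))
             \<le> 2 * \<gamma> / (1 - \<gamma> * norm (v - u) - \<gamma> * norm (u - x0)) ^ 3
               - 2 * \<gamma> / (1 - \<gamma> * norm (u - x0)) ^ 3"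
    and "norm (blinfun_inv (F' x0) (F x0)) \<le> \<beta>"
    and "norm (bilinear_postcomp (blinfun_inv (F' x0)) (F'' x0)) \<le> 2 * \<gamma>"
    and "\<alpha> = \<beta> * \<gamma>"
    and "\<alpha> < 3 - 2 * sqrt 2"
    and "tstar = (1 + \<alpha> - sqrt ((1 + \<alpha>)\<^sup>2 - 8 * \<alpha>)) / (4 * \<gamma>)"
    and "tstarstar = (1 + \<alpha> + sqrt ((1 + \<alpha>)\<^sup>2 - 8 * \<alpha>)) / (4 * \<gamma>)"
    and "x = halley_seq F F' F'' x0"
    and "t = scalar_halley_seq (majorant \<beta> \<gamma>) 0"
  shows "halley_well_defined D F F' F'' x0 \<and>
         (\<forall>k. x k \<in> ball x0 tstar) \<and>
         (\<forall>k. 0 \<le> t k \<and> t k < 1 / \<gamma> \<and> t k \<noteq> tstar \<and>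
             deriv (majorant \<beta> \<gamma>) (t k) \<noteq> 0 \<and> scalar_halley_L (majorant \<beta> \<gamma>) (t k) \<noteq> 1) \<and>
         (\<exists>xstar.
           x \<longlonglongrightarrow> xstar \<and> xstar \<in> closure (ball x0 tstar) \<and> F xstar = 0 \<and>
           xstar \<in> ball x0 tstarstar \<and> (\<forall>z \<in> ball x0 tstarstar. F z = 0 \<longrightarrow> z = xstar) \<and>
           (\<forall>k. norm (xstar - x (Suc k))
                  \<le> (tstar - t (Suc k)) * (norm (xstar - x k) / (tstar - t k)) ^ 3) \<and>
           q_cubically_convergent x xstar \<and>
           (\<forall>k. norm (xstar - x (Suc k))
                  \<le> 8 * \<gamma>\<^sup>2 / (3 * (2 * (1 - \<gamma> * tstar)\<^sup>2 - 1)\<^sup>2) * norm (xstar - x k) ^ 3))"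
proof -
  let ?A = "blinfun_inv (F' x0)"
  define G where "G = (\<lambda>z. ?A (F z))"
  define G' where "G' = (\<lambda>z. ?A o\<^sub>L F' z)"
  define G'' where "G'' = (\<lambda>z. bilinear_postcomp ?A (F'' z))"
  have in_D: "z \<in> D" if "norm (z - x0) < 1 / \<gamma>" for z
    using assms(11) that by (auto simp: dist_norm norm_minus_commute)
  interpret halley_operator \<beta> \<gamma> tstar tstarstar G G' G'' x0
  proof
    show "\<beta> * \<gamma> < 3 - 2 * sqrt 2" using assms(15,16) by simp
    show "tstar = (1 + \<beta> * \<gamma> - sqrt ((1 + \<beta> * \<gamma>)\<^sup>2 - 8 * (\<beta> * \<gamma>))) / (4 * \<gamma>)"
      "tstarstar = (1 + \<beta> * \<gamma> + sqrt ((1 + \<beta> * \<gamma>)\<^sup>2 - 8 * (\<beta> * \<gamma>))) / (4 * \<gamma>)"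
      using assms(15,17,18) by simp_all
    show "(G has_derivative blinfun_apply (G' z)) (at z)" if "norm (z - x0) < 1 / \<gamma>" for z
      using bounded_linear.has_derivative[OF blinfun.bounded_linear_right assms(4)[OF in_D[OF that]]]
      by (simp add: G_def G'_def blinfun_compose.rep_eq o_def)
    show "(G' has_derivative blinfun_apply (G'' z)) (at z)" if "norm (z - x0) < 1 / \<gamma>" for z
    proof -
      have "blinfun_apply (G'' z) = (\<lambda>h. ?A o\<^sub>L F'' z h)"
        by (intro ext blinfun_eqI) (simp add: G''_def)
      then show ?thesis
        unfolding G'_def using bounded_linear.has_derivative[OF
            bounded_bilinear.bounded_linear_right[OF bounded_bilinear_blinfun_compose]
            assms(5)[OF in_D[OF that]]] by simp
    qed
    show "norm (G x0) \<le> \<beta>" using assms(13) by (simp add: G_def)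
    show "G' x0 = id_blinfun" using blinfun_inv(1)[OF assms(8)] by (simp add: G'_def)
    show "norm (G'' x0) \<le> 2 * \<gamma>" using assms(14) by (simp add: G''_def)
    show "norm (G'' v - G'' u) \<le> majorant_d2 \<gamma> (norm (v - u) + norm (u - x0)) - majorant_d2 \<gamma> (norm (u - x0))"
      if uv: "norm (v - u) + norm (u - x0) < 1 / \<gamma>" for u v
    proof -
      have "norm (v - x0) < 1 / \<gamma>" "norm (u - x0) < 1 / \<gamma>"
        using uv norm_triangle_ineq[of "v - u" "u - x0"] norm_ge_zero[of "v - u"]
        by (simp, linarith)
      then have "u \<in> ball x0 (1 / \<gamma>)" "v \<in> ball x0 (1 / \<gamma>)"
        by (simp_all add: dist_norm norm_minus_commute)
      moreover have "G'' v - G'' u = bilinear_postcomp ?A (F'' v - F'' u)"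
        by (intro blinfun_eqI) (simp add: G''_def blinfun.diff_left blinfun.diff_right)
      ultimately show ?thesis
        using assms(12)[OF _ _ uv] by (simp add: majorant_d2_def algebra_simps)
    qed
  qed (use assms(9,10) in auto)
  have G_eq_0: "G z = 0 \<longleftrightarrow> F z = 0" for z
    using blinfun_inv_apply(2)[OF assms(8), of "F z"] by (metis G_def blinfun.zero_right)
  have "blinfun_invertible (G' (halley_seq G G' G'' x0 k))" for k
    using xk_invertible(1)[of k] by (simp add: xk_def)
  then have x: "x k = xk k" for k
    unfolding assms(19) xk_def unfolding G_def G'_def G''_def by (rule halley_seq_precomposed[OF assms(8)])
  have t: "t k = tk k" for k by (simp add: assms(20) tk_def)
  have x_ball: "x k \<in> ball x0 tstar" for k
    using xk_bounds(1)[of k] tk_bounds(2)[of k] by (simp add: x dist_norm norm_minus_commute)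
  have inv_\<gamma>: "s < 1 / \<gamma>" if "s \<le> tstar" for s
    using \<gamma>_times_less_1[OF that] less_inverse_iff by simp
  have well_defined: "halley_well_defined D F F' F'' x0"
    unfolding halley_well_defined_def Let_def assms(19)[symmetric] x
  proof (intro allI conjI)
    fix k
    show "xk k \<in> D" using xk_bounds(1)[of k] tk_bounds(2)[of k] inv_\<gamma>[of "tk k"] by (intro in_D) simp
    show "blinfun_invertible (F' (xk k))"
      using blinfun_inv_precomposed(1)[OF assms(8)] xk_invertible(1)[of k] by (simp add: G'_def)
    show "blinfun_invertible (id_blinfun - halley_L F F' F'' (xk k))"
      using xk_invertible[of k] halley_L_precomposed(1)[OF assms(8)] by (simp add: G_def G'_def G''_def)
  qed
  have scalar: "0 \<le> t k \<and> t k < 1 / \<gamma> \<and> t k \<noteq> tstar \<and> deriv (majorant \<beta> \<gamma>) (t k) \<noteq> 0 \<and>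
      scalar_halley_L (majorant \<beta> \<gamma>) (t k) \<noteq> 1" for k
    using tk_bounds[of k] inv_\<gamma>[of "tk k"] majorant_d1_neg[of "tk k"] scalar_step(2)[OF tk_bounds]
      \<gamma>_times_less_1[of "tk k"]
    by (auto simp: t deriv_majorant less_imp_neq)
  obtain xs where lim: "xk \<longlonglongrightarrow> xs" and dist: "\<And>k. norm (xs - xk k) \<le> tstar - tk k"
    and ball: "norm (xs - x0) \<le> tstar" and zero: "G xs = 0"
    by (rule xk_convergent) blast
  have x_lim: "x \<longlonglongrightarrow> xs" using lim by (simp add: x[abs_def])
  have cubic: "norm (xs - x (Suc k))
      \<le> 8 * \<gamma>\<^sup>2 / (3 * (2 * (1 - \<gamma> * tstar)\<^sup>2 - 1)\<^sup>2) * norm (xs - x k) ^ 3" for k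
  proof -
    \<comment> \<open>The argument gives three quarters of the stated constant.\<close>
    have "2 * \<gamma>\<^sup>2 / (2 * wa\<^sup>2 - 1)\<^sup>2 = 3 / 4 * (8 * \<gamma>\<^sup>2 / (3 * (2 * wa\<^sup>2 - 1)\<^sup>2))" by simp
    also have "\<dots> \<le> 8 * \<gamma>\<^sup>2 / (3 * (2 * wa\<^sup>2 - 1)\<^sup>2)" by (rule mult_left_le_one_le) auto
    finally have "2 * \<gamma>\<^sup>2 / (2 * wa\<^sup>2 - 1)\<^sup>2 * norm (xs - x k) ^ 3
        \<le> 8 * \<gamma>\<^sup>2 / (3 * (2 * wa\<^sup>2 - 1)\<^sup>2) * norm (xs - x k) ^ 3" by (rule mult_right_mono) simp
    then show ?thesis
      using xk_cubic[OF zero dist, of k] unfolding x wa_def by linarith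
  qed
  show ?thesis
  proof (intro conjI exI[of _ xs] allI ballI impI)
    show "xs \<in> closure (ball x0 tstar)" using x_ball x_lim closure_sequential by blast
    show "F xs = 0" using zero G_eq_0 by simp
    show "xs \<in> ball x0 tstarstar" using ball ts_less by (simp add: dist_norm norm_minus_commute)
    show "z = xs" if "z \<in> ball x0 tstarstar" "F z = 0" for z
      using zero_unique[OF zero ball, of z] that G_eq_0 by (simp add: dist_norm norm_minus_commute)
    show "norm (xs - x (Suc k)) \<le> (tstar - t (Suc k)) * (norm (xs - x k) / (tstar - t k)) ^ 3" for k
      unfolding x t by (rule xk_error[OF zero dist])
    show "q_cubically_convergent x xs"
      unfolding q_cubically_convergent_def using x_lim cubic
      by (intro conjI exI[of _ "8 * \<gamma>\<^sup>2 / (3 * (2 * (1 - \<gamma> * tstar)\<^sup>2 - 1)\<^sup>2)"] exI[of _ 0]) auto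
  qed (use well_defined x_ball scalar x_lim cubic in \<open>auto simp del: power_Suc\<close>)
qed

end
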